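(* There exist absolute constants $c,C>0$ such that for every integer $k\geq 2$ there is $n_0=n_0(k)$ such that for all integers $n\geq n_0$, $$c\, k2^k n^2 \leq \hat r(B_n^{(k)}) \leq C\, k2^k n^2 .$$ That is, for every fixed $k\ge 2$ and all sufficiently large $n$, $\hat r(B_n^{(k)})=\Theta(k2^kn^2)$, with implied constants independent of $k$ and $n$.
   Context: All graphs are finite and simple. For positive integers $k$ and $n$, the book graph $B_n^{(k)}$ consists of $n$ copies of $K_{k+1}$ glued along a common $K_k$; equivalently, it is the join of $K_k$ with an independent set of $n$ vertices. A copy of $H$ in $G$ means a (not necessarily induced) subgraph of $G$ isomorphic to $H$. A graph $G$ is Ramsey for a graph $H$ if every two-coloring of the edges of $G$ contains a monochromatic copy of $H$. The size Ramsey number $\hat r(H)$ is the minimum number of edges in a graph $G$ which is Ramsey for $H$. *)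

theory Defs
  imports Complex_Main "HOL-Library.Ramsey"
begin

text \<open>A graph is a pair of a vertex set and an edge set, where edges are two-element sets of
  vertices; \<open>[V]\<^bsup>2\<^esup>\<close> is the library notation for the set of two-element subsets of \<open>V\<close>.\<close>

type_synonym 'a graph = "'a set \<times> 'a set set"

abbreviation verts :: "'a graph \<Rightarrow> 'a set" where "verts \<equiv> fst"

abbreviation edges :: "'a graph \<Rightarrow> 'a set set" where "edges \<equiv> snd"

definition finite_simple_graph :: "'a graph \<Rightarrow> bool" where
  "finite_simple_graph G \<longleftrightarrow> finite (verts G) \<and> edges G \<subseteq> [verts G]\<^bsup>2\<^esup>"

definition subgraph :: "'a graph \<Rightarrow> 'a graph \<Rightarrow> bool" where
  "subgraph F G \<longleftrightarrow>
     finite_simple_graph F \<and> verts F \<subseteq> verts G \<and> edges F \<subseteq> edges G"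

definition isomorphic :: "'a graph \<Rightarrow> 'b graph \<Rightarrow> bool" where
  "isomorphic F H \<longleftrightarrow>
     (\<exists>f. bij_betw f (verts F) (verts H) \<and> edges H = (\<lambda>e. f ` e) ` edges F)"

definition copy_of :: "'a graph \<Rightarrow> 'b graph \<Rightarrow> 'a graph \<Rightarrow> bool" where
  "copy_of F H G \<longleftrightarrow> subgraph F G \<and> isomorphic F H"

text \<open>A two-coloring is a function into \<^typ>\<open>bool\<close>; only its values on the edges of \<open>G\<close> matter.\<close>

definition ramsey_for :: "'a graph \<Rightarrow> 'b graph \<Rightarrow> bool" where
  "ramsey_for G H \<longleftrightarrow>
     (\<forall>\<chi> :: 'a set \<Rightarrow> bool. \<exists>F. copy_of F H G \<and> (\<exists>c. \<forall>e\<in>edges F. \<chi> e = c))"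

text \<open>Every finite graph is isomorphic to one with vertices in \<^typ>\<open>nat\<close>, so it suffices to
  minimize over these. For finite simple \<open>H\<close> the minimum exists by Ramsey's theorem.\<close>

definition size_ramsey :: "'b graph \<Rightarrow> nat" where
  "size_ramsey H =
     (LEAST m. \<exists>G :: nat graph. finite_simple_graph G \<and> ramsey_for G H \<and> card (edges G) = m)"

text \<open>The join of the complete graph on \<open>{..<k}\<close> with the independent set \<open>{k..<k+n}\<close>.\<close>

definition book :: "nat \<Rightarrow> nat \<Rightarrow> nat graph" where
  "book k n =
     ({..<k} \<union> {k..<k+n}, [{..<k}]\<^bsup>2\<^esup> \<union> {{u, v} | u v. u \<in> {..<k} \<and> v \<in> {k..<k+n}})"

end

theory Submission
  imports Defs "HOL-Library.FuncSet"
begin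

text \<open>
  Upper bound: take \<open>9kn\<close> pairwise adjacent vertices \<open>A\<close> and join them to about \<open>2^(k+1) n\<close> further
  vertices \<open>B\<close>. Cover most of \<open>A\<close> by large monochromatic cliques, say mostly red ones. If there is no
  red book, then all but \<open>2n\<close> vertices have many blue neighbours in a given red clique; as in the
  proof of the Erdos-Stone theorem this yields \<open>k\<close> large red cliques with all edges between them blue.
  A red \<open>k\<close>-subset of one of these cliques or a blue transversal of all of them then has, on
  average, a proportion of at least about \<open>2^(-k)\<close> of \<open>B\<close> as its pages.

  Lower bound: in a graph with few edges, less than \<open>kn/512\<close> vertices have degree at least \<open>2^k n/128\<close>.
  Order them by decreasing degree and cut them into blocks of \<open>n/4\<close> vertices; colour edges inside
  a block red and edges between blocks blue. All other edges are coloured at random, red with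
  probability 1/2, except that the probability at a vertex of the \<open>j\<close>-th block is lowered to about
  \<open>(j/k)^(1/k)/2\<close>, which compensates for its degree being as large as \<open>2^k kn/j\<close>. A union bound over
  the possible spines, in the form of an exponential moment, shows that some colouring has no
  monochromatic book.
\<close>
section \<open>The upper bound\<close>

text \<open>The falling factorials are compared factor by factor:
  \<open>(m - k) / t * (t - i)\<close> is at most \<open>m - k\<close>, hence at most
  \<open>m - i\<close>. A density \<open>m / t\<close> thus becomes a proportion of
  \<open>k\<close>-subsets, at the price of a shift by \<open>k\<close>.\<close>

lemma binomial_ratio:
  assumes "k \<le> m" "m \<le> t" "t > 0"
  shows "((real m - real k) / real t) ^ k * real (t choose k) \<le> real (m choose k)"
proof -
  have eq: "real (x choose k) * fact k = (\<Prod>i=0..<k. real x - real i)" for x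
    by (simp add: binomial_gbinomial gbinomial_prod_rev)
  have "((real m - real k) / real t) ^ k * (\<Prod>i=0..<k. real t - real i)
      = (\<Prod>i=0..<k. (real m - real k) / real t * (real t - real i))"
    by (simp only: prod.distrib) simp
  also have "\<dots> \<le> (\<Prod>i=0..<k. real m - real i)"
  proof (rule prod_mono, intro conjI)
    fix i assume i: "i \<in> {0..<k}"
    show "0 \<le> (real m - real k) / real t * (real t - real i)"
      using i assms by simp
    have "(real m - real k) * ((real t - real i) / real t) \<le> (real m - real k) * 1"
      using assms i by (intro mult_left_mono) auto
    then show "(real m - real k) / real t * (real t - real i) \<le> real m - real i"
      using i by simp
  qed
  finally have "((real m - real k) / real t) ^ k * real (t choose k) * fact k
      \<le> real (m choose k) * fact k"
    unfolding eq[symmetric] by (simp add: mult.assoc)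
  then show ?thesis by simp
qed

lemma sum_card_supersets:
  assumes "finite R" "finite W" "\<And>w. w \<in> W \<Longrightarrow> N w \<subseteq> R"
  shows "(\<Sum>S | S \<subseteq> R \<and> card S = k. card {w \<in> W. S \<subseteq> N w}) = (\<Sum>w\<in>W. card (N w) choose k)"
proof -
  have "(\<Sum>S | S \<subseteq> R \<and> card S = k. card {w \<in> W. S \<subseteq> N w})
     = (\<Sum>S | S \<subseteq> R \<and> card S = k. \<Sum>w\<in>W. of_bool (S \<subseteq> N w))"
    using assms by (simp add: Int_def)
  also have "\<dots> = (\<Sum>w\<in>W. \<Sum>S | S \<subseteq> R \<and> card S = k. of_bool (S \<subseteq> N w))"
    by (rule sum.swap)
  also have "\<dots> = (\<Sum>w\<in>W. card (N w) choose k)"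
  proof (rule sum.cong[OF refl])
    fix w assume w: "w \<in> W"
    have fin: "finite {S. S \<subseteq> R \<and> card S = k}"
      using assms by (auto intro: finite_subset[of _ "Pow R"])
    have "(\<Sum>S | S \<subseteq> R \<and> card S = k. of_bool (S \<subseteq> N w))
        = card {S. S \<subseteq> N w \<and> card S = k}"
      using assms(3)[OF w] fin by (auto simp: Int_def intro!: arg_cong[where f = card])
    also have "\<dots> = card (N w) choose k"
      using assms w by (intro n_subsets) (auto intro: finite_subset)
    finally show "(\<Sum>S | S \<subseteq> R \<and> card S = k. of_bool (S \<subseteq> N w)) = card (N w) choose k" .
  qed
  finally show ?thesis .
qed

lemma sum_binomial_le:
  assumes "finite R" "finite W" "\<And>w. w \<in> W \<Longrightarrow> N w \<subseteq> R"
    and "\<And>S. S \<subseteq> R \<Longrightarrow> card S = k \<Longrightarrow> card {w \<in> W. S \<subseteq> N w} \<le> n"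
  shows "(\<Sum>w\<in>W. card (N w) choose k) \<le> n * (card R choose k)"
proof -
  have "(\<Sum>S | S \<subseteq> R \<and> card S = k. card {w \<in> W. S \<subseteq> N w}) \<le> (\<Sum>S | S \<subseteq> R \<and> card S = k. n)"
    using assms(4) by (intro sum_mono) auto
  also have "\<dots> = n * (card R choose k)"
    using n_subsets[OF assms(1), of k] by simp
  finally show ?thesis
    using sum_card_supersets[OF assms(1,2,3)] by simp
qed

text \<open>A vertex missing less than the fraction \<open>1 / (4k)\<close> of \<open>R\<close> is
  joined to all of \<open>S\<close> for at least half of the \<open>k\<close>-subsets
  \<open>S\<close> of \<open>R\<close>. Since each \<open>S\<close> has at most \<open>n\<close>
  common neighbours in \<open>W\<close>, double counting leaves room for at most
  \<open>2 * n\<close> such vertices.\<close>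

lemma card_few_non_neighbours_le:
  assumes fin: "finite R" "finite W" and k: "k \<ge> 1" and R: "card R \<ge> 4 * k\<^sup>2"
    and nobook: "\<And>S. S \<subseteq> R \<Longrightarrow> card S = k \<Longrightarrow> card {w \<in> W. \<forall>u\<in>S. {u, w} \<in> E} \<le> n"
  shows "card {w \<in> W. 4 * k * card {u \<in> R. {u, w} \<notin> E} < card R} \<le> 2 * n"
proof -
  define t where "t = card R"
  define X where "X = {w \<in> W. 4 * k * card {u \<in> R. {u, w} \<notin> E} < t}"
  define N where "N w = {u \<in> R. {u, w} \<in> E}" for w
  have kk: "k \<le> k\<^sup>2" using k by (simp add: power2_eq_square)
  have t: "t > 0" "t \<ge> 4 * k\<^sup>2" "k \<le> t" using R k kk unfolding t_def by auto
  have pos: "real (t choose k) > 0" using t by simp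
  have large: "real (t choose k) / 2 \<le> real (card (N w) choose k)" if "w \<in> X" for w
  proof -
    have lt: "4 * k * card {u \<in> R. {u, w} \<notin> E} < t" using that by (simp add: X_def)
    have "card (N w) + card {u \<in> R. {u, w} \<notin> E} = card (N w \<union> {u \<in> R. {u, w} \<notin> E})"
      using fin by (intro card_Un_disjoint[symmetric]) (auto simp: N_def)
    also have "N w \<union> {u \<in> R. {u, w} \<notin> E} = R" by (auto simp: N_def)
    finally have sum: "card (N w) + card {u \<in> R. {u, w} \<notin> E} = t" by (simp add: t_def)
    have rs: "real (card (N w)) = real t - real (card {u \<in> R. {u, w} \<notin> E})"
      using sum by linarith
    have lt': "real (card {u \<in> R. {u, w} \<notin> E}) * (4 * real k) \<le> real t"
      using lt by (metis (no_types, lifting) less_imp_le mult.commute of_nat_le_iff of_nat_mult of_nat_numeral)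
    have q: "4 * real k * real k \<le> real t"
      using t(2) by (metis (mono_tags) of_nat_le_iff of_nat_mult of_nat_numeral power2_eq_square mult.assoc)
    have "2 * real k * (real (card {u \<in> R. {u, w} \<notin> E}) + real k) \<le> real t"
      using lt' q by (simp add: algebra_simps)
    then have b1: "real k * ((real (card {u \<in> R. {u, w} \<notin> E}) + real k) / real t) \<le> 1 / 2"
      using t by (simp add: field_simps)
    \<comment> \<open>The missing vertices and the shift by \<open>k\<close> each contribute at most
      \<open>1 / (4k)\<close> to \<open>z\<close>, the latter because \<open>4 * k^2 <= t\<close>.
      So \<open>k * z\<close> is at most 1/2 and Bernoulli's inequality gives
      \<open>(1 - z)^k >= 1/2\<close>.\<close>
    define z where "z = (real (card {u \<in> R. {u, w} \<notin> E}) + real k) / real t"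
    have z0: "z \<ge> 0" by (simp add: z_def)
    have z1: "real k * z \<le> 1 / 2" using b1 by (simp add: z_def)
    have "z \<le> real k * z" using k z0 by (simp add: mult_le_cancel_right1)
    then have "z \<le> 1 / 2" using z1 by linarith
    have eq: "(real (card (N w)) - real k) / real t = 1 + - z"
      using t rs by (simp add: z_def field_simps)
    have "1 / 2 \<le> 1 + real k * - z" using z1 by simp
    also have "\<dots> \<le> (1 + - z) ^ k"
      using \<open>z \<le> 1 / 2\<close> by (intro Bernoulli_inequality) simp
    finally have half: "1 / 2 \<le> ((real (card (N w)) - real k) / real t) ^ k" unfolding eq .
    have "(real (card (N w)) - real k) / real t \<ge> 0" using eq \<open>z \<le> 1 / 2\<close> by simp
    then have "k \<le> card (N w)" using t by (simp add: field_simps zero_le_divide_iff)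
    then have "((real (card (N w)) - real k) / real t) ^ k * real (t choose k) \<le> real (card (N w) choose k)"
      using t sum by (intro binomial_ratio) auto
    moreover have "1 / 2 * real (t choose k) \<le> ((real (card (N w)) - real k) / real t) ^ k * real (t choose k)"
      using half by (intro mult_right_mono) auto
    ultimately show ?thesis by simp
  qed
  have finX: "finite X" using fin by (simp add: X_def)
  have "(\<Sum>w\<in>X. card (N w) choose k) \<le> n * (card R choose k)"
  proof (rule sum_binomial_le[OF fin(1) finX])
    show "N w \<subseteq> R" for w by (auto simp: N_def)
    fix S assume S: "S \<subseteq> R" "card S = k"
    have "card {w \<in> X. S \<subseteq> N w} \<le> card {w \<in> W. \<forall>u\<in>S. {u, w} \<in> E}"
      using fin by (intro card_mono) (auto simp: X_def N_def)
    then show "card {w \<in> X. S \<subseteq> N w} \<le> n" using nobook[OF S] by linarith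
  qed
  then have "(\<Sum>w\<in>X. real (card (N w) choose k)) \<le> real n * real (t choose k)"
    unfolding t_def by (metis (mono_tags, lifting) of_nat_le_iff of_nat_mult of_nat_sum sum.cong)
  moreover have "(\<Sum>w\<in>X. real (t choose k) / 2) \<le> (\<Sum>w\<in>X. real (card (N w) choose k))"
    by (intro sum_mono large)
  ultimately have "real (card X) * real (t choose k) \<le> 2 * real n * real (t choose k)"
    by simp
  then have "real (card X) \<le> 2 * real n" using pos by simp
  then show ?thesis unfolding X_def t_def by linarith
qed

section \<open>Cliques of one colour joined completely in the other colour\<close>

text \<open>\<open>E\<close> is one colour class, its complement the other. The single parameter
  \<open>L\<close> is an inverse density, a clique size and a lower bound for \<open>n\<close> at
  once, so that the property becomes weaker as \<open>L\<close> decreases. The last clause is what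
  the absence of a book in colour \<open>E\<close> provides.\<close>

definition clique_rich :: "nat \<Rightarrow> nat \<Rightarrow> nat \<Rightarrow> 'a set \<Rightarrow> 'a set set \<Rightarrow> bool" where
  "clique_rich k n L A E \<longleftrightarrow> finite A \<and> L \<le> n \<and> 4 * k * n \<le> card A \<and>
    (\<forall>X\<subseteq>A. card A \<le> L * card X \<longrightarrow> (\<exists>Q\<subseteq>X. card Q = L \<and> clique Q E)) \<and>
    (\<forall>Q\<subseteq>A. clique Q E \<longrightarrow> 4 * k\<^sup>2 \<le> card Q \<longrightarrow>
       card {w \<in> A - Q. 4 * k * card {u \<in> Q. {u, w} \<notin> E} < card Q} \<le> 2 * n)"

definition separated_cliques :: "nat \<Rightarrow> nat \<Rightarrow> 'a set \<Rightarrow> 'a set set \<Rightarrow> (nat \<Rightarrow> 'a set) \<Rightarrow> bool" where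
  "separated_cliques r s A E Q \<longleftrightarrow>
    (\<forall>i<r. Q i \<subseteq> A \<and> card (Q i) = s \<and> clique (Q i) E) \<and>
    (\<forall>i<r. \<forall>j<i. \<forall>u\<in>Q i. \<forall>v\<in>Q j. u \<noteq> v \<and> {u, v} \<notin> E)"

text \<open>At most \<open>3kn\<close> vertices are lost in passing to those with many non-neighbours in each clique found
  so far, and by pigeonhole a positive proportion of the remaining ones, hence a whole clique, is
  attached to the earlier cliques in the same way.\<close>

lemma clique_rich_imp_separated_cliques:
  assumes k: "k \<ge> 1" and r: "r \<le> k"
  shows "\<exists>L\<ge>1. \<forall>(A :: 'a set) E n. clique_rich k n L A E \<longrightarrow> (\<exists>Q. separated_cliques r s A E Q)"
  using r
proof (induction r arbitrary: s)
  case 0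
  then show ?case by (auto simp: separated_cliques_def)
next
  case (Suc r)
  \<comment> \<open>A vertex with at least the fraction \<open>1 / (4k)\<close> of non-neighbours in
    a clique of size \<open>t\<close> has at least \<open>s + k\<close> of them there. The summand
    \<open>k\<close> makes \<open>t >= 4 * k^2\<close>, as the last clause of
    \<open>clique_rich\<close> demands.\<close>
  define t where "t = 4 * k * (s + k)"
  obtain L1 where L1: "L1 \<ge> 1"
    and IH: "\<And>(A :: 'a set) E n. clique_rich k n L1 A E \<Longrightarrow> \<exists>Q. separated_cliques r t A E Q"
    using Suc.IH[of t] Suc.prems by (meson Suc_leD)
  \<comment> \<open>The summands provide for the induction hypothesis, for the density left after
    the pigeonhole step, for a clique of size \<open>s + 1\<close>, and for
    \<open>n >= t\<close>.\<close>
  define L where "L = L1 + 4 * 2 ^ (r * t) + s + t"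
  have "\<exists>Q. separated_cliques (Suc r) s A E Q" if rich: "clique_rich k n L A E"
    for A :: "'a set" and E n
  proof -
    have fin: "finite A" and n: "n \<ge> L" and cA: "card A \<ge> 4 * k * n"
      and dense: "\<And>X. X\<subseteq>A \<Longrightarrow> card A \<le> L * card X \<Longrightarrow> (\<exists>Q\<subseteq>X. card Q = L \<and> clique Q E)"
      and few: "\<And>Q. Q\<subseteq>A \<Longrightarrow> clique Q E \<Longrightarrow> 4 * k\<^sup>2 \<le> card Q \<Longrightarrow>
       card {w \<in> A - Q. 4 * k * card {u \<in> Q. {u, w} \<notin> E} < card Q} \<le> 2 * n"
      using rich unfolding clique_rich_def by blast+
    have dense': "\<exists>Q\<subseteq>X. card Q = l \<and> clique Q E"
      if XA: "X \<subseteq> A" and "card A \<le> l' * card X" and l: "l \<le> L" and "l' \<le> L" for X l l'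
    proof -
      have "card A \<le> L * card X" using that(2,4) by (meson mult_le_mono1 order_trans)
      then obtain Q where Q: "Q \<subseteq> X" "card Q = L" "clique Q E" using dense[OF XA] by blast
      obtain Q' where "Q' \<subseteq> Q" "card Q' = l"
        using Q(2) l by (metis obtain_subset_with_card_n)
      then show ?thesis using Q smaller_clique by (metis subset_trans)
    qed
    have rich1: "clique_rich k n L1 A E"
    proof -
      have "L1 \<le> L" by (simp add: L_def)
      then have "\<forall>X\<subseteq>A. card A \<le> L1 * card X \<longrightarrow> (\<exists>Q\<subseteq>X. card Q = L1 \<and> clique Q E)"
        using dense' by blast
      then show ?thesis
        using fin n cA few \<open>L1 \<le> L\<close> unfolding clique_rich_def by (meson order_trans)
    qed
    obtain Q where "separated_cliques r t A E Q" using IH[OF rich1] by blast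
    then have sep: "i < r \<Longrightarrow> Q i \<subseteq> A \<and> card (Q i) = t \<and> clique (Q i) E"
      "i < r \<Longrightarrow> j < i \<Longrightarrow> u \<in> Q i \<Longrightarrow> v \<in> Q j \<Longrightarrow> u \<noteq> v \<and> {u, v} \<notin> E" for i j u v
      unfolding separated_cliques_def by simp_all
    note Q = sep(1)[THEN conjunct1] sep(1)[THEN conjunct2, THEN conjunct1]
      sep(1)[THEN conjunct2, THEN conjunct2] and cross = sep(2)
    define bad where "bad i = Q i \<union> {w \<in> A - Q i. 4 * k * card {u \<in> Q i. {u, w} \<notin> E} < card (Q i)}" for i
    have t_ge: "t \<ge> 4 * k\<^sup>2" by (simp add: t_def power2_eq_square algebra_simps)
    have bad: "card (bad i) \<le> t + 2 * n" if "i < r" for i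
    proof -
      have "card (bad i) \<le> card (Q i) + card {w \<in> A - Q i. 4 * k * card {u \<in> Q i. {u, w} \<notin> E} < card (Q i)}"
        unfolding bad_def by (rule card_Un_le)
      then show ?thesis using few[OF Q(1,3)] Q(2) t_ge that by fastforce
    qed
    define W where "W = A - (\<Union>i<r. bad i)"
    have "card (\<Union>i<r. bad i) \<le> (\<Sum>i<r. card (bad i))" by (rule card_UN_le) simp
    also have "\<dots> \<le> (\<Sum>i<r. 3 * n)"
      by (intro sum_mono) (use bad n in \<open>fastforce simp: L_def\<close>)
    also have "\<dots> \<le> 3 * k * n" using Suc.prems by simp
    finally have "card (\<Union>i<r. bad i) \<le> 3 * k * n" .
    moreover have "card A - card (\<Union>i<r. bad i) \<le> card W"
      unfolding W_def using fin Q(1) by (intro diff_card_le_card_Diff finite_UN_I) (auto simp: bad_def intro: finite_subset)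
    ultimately have cW: "card A \<le> 4 * card W" using cA by linarith
    have Wfin: "finite W" and WA: "W \<subseteq> A" using fin by (auto simp: W_def)
    have Wbig: "s \<le> card {u \<in> Q i. {u, w} \<notin> E}" and WQ: "w \<notin> Q i" if "i < r" "w \<in> W" for i w
    proof -
      show "w \<notin> Q i" using that by (auto simp: W_def bad_def)
      then have "\<not> 4 * k * card {u \<in> Q i. {u, w} \<notin> E} < card (Q i)"
        using that by (auto simp: W_def bad_def)
      then have "4 * k * (s + k) \<le> 4 * k * card {u \<in> Q i. {u, w} \<notin> E}"
        using Q(2)[OF that(1)] by (auto simp: t_def not_less)
      then show "s \<le> card {u \<in> Q i. {u, w} \<notin> E}" using k by simp
    qed
    define U where "U = (\<Union>i<r. Q i)"
    have Ufin: "finite U" using Q(1) fin by (auto simp: U_def intro: finite_subset)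
    have "card U \<le> (\<Sum>i<r. card (Q i))" unfolding U_def by (rule card_UN_le) simp
    also have "\<dots> = r * t" using Q(2) by simp
    finally have cU: "card U \<le> r * t" .
    define f where "f w = {u \<in> U. {u, w} \<notin> E}" for w
    have "\<exists>y\<in>Pow U. card (f -` {y} \<inter> W) * card (Pow U) \<ge> card W"
      using Wfin Ufin by (intro pigeonhole_card) (auto simp: f_def)
    then obtain y where y: "card W \<le> card (f -` {y} \<inter> W) * 2 ^ card U"
      using Ufin by (auto simp: card_Pow)
    define X where "X = f -` {y} \<inter> W"
    have "card W \<le> card X * 2 ^ (r * t)"
      using y cU by (metis X_def mult_le_mono2 order_trans power_increasing one_le_numeral)
    then have cX: "card A \<le> (4 * 2 ^ (r * t)) * card X" using cW by (simp add: mult.commute)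
    \<comment> \<open>The size is \<open>s + 1\<close> so that \<open>P\<close> has a vertex
      \<open>p\<close> even for \<open>s = 0\<close>. The sets \<open>S i\<close> are chosen among
      the non-neighbours of \<open>p\<close>, which are common to all of \<open>P\<close>.\<close>
    then obtain P where P: "P \<subseteq> X" "card P = s + 1" "clique P E"
      using dense'[of X "4 * 2 ^ (r * t)" "s + 1"] WA L1 by (auto simp: L_def X_def)
    then obtain p where p: "p \<in> P" by fastforce
    obtain P' where P': "P' \<subseteq> P" "card P' = s" using P(2) by (metis le_add1 obtain_subset_with_card_n)
    have "\<exists>S. S \<subseteq> {u \<in> Q i. {u, p} \<notin> E} \<and> card S = s" if "i < r" for i
    proof -
      have "p \<in> W" using p P(1) by (auto simp: X_def)
      then show ?thesis using obtain_subset_with_card_n[OF Wbig[OF that]] by metis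
    qed
    then obtain S where S: "\<And>i. i < r \<Longrightarrow> S i \<subseteq> {u \<in> Q i. {u, p} \<notin> E} \<and> card (S i) = s" by metis
    have SP: "u \<noteq> v \<and> {u, v} \<notin> E" if "i < r" "u \<in> S i" "v \<in> P'" for i u v
    proof -
      have "f v = f p" using that(3) P' P(1) p by (auto simp: X_def)
      moreover have "u \<in> f p" using S[OF that(1)] that by (auto simp: f_def U_def)
      ultimately have "{u, v} \<notin> E" by (auto simp: f_def)
      moreover have "v \<in> W" "u \<in> Q i" using that P' P(1) S[OF that(1)] by (auto simp: X_def)
      ultimately show ?thesis using WQ[OF that(1)] by auto
    qed
    define Q' where "Q' i = (if i < r then S i else P')" for i
    have "Q' i \<subseteq> A \<and> card (Q' i) = s \<and> clique (Q' i) E" if "i < Suc r" for i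
    proof (cases "i < r")
      case True
      then show ?thesis using S[OF True] Q(1,3)[OF True] smaller_clique[of "Q i" E "S i"]
        by (auto simp: Q'_def)
    next
      case False
      then show ?thesis using P P' smaller_clique[of P E P'] WA by (auto simp: Q'_def X_def)
    qed
    moreover have "u \<noteq> v \<and> {u, v} \<notin> E" if "i < Suc r" "j < i" "u \<in> Q' i" "v \<in> Q' j" for i j u v
    proof (cases "i < r")
      case True
      then show ?thesis using cross[of i j u v] that S[of i] S[of j] by (auto simp: Q'_def)
    next
      case False
      then have "i = r" "j < r" using that by auto
      then show ?thesis using SP[of j v u] that by (auto simp: Q'_def insert_commute)
    qed
    ultimately show ?thesis unfolding separated_cliques_def by blast
  qed
  moreover have "L \<ge> 1" using L1 by (simp add: L_def)
  ultimately show ?case by (intro exI[of _ L]) auto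
qed

section \<open>Sets in which every large part contains a clique\<close>

text \<open>Models a disjoint union of cliques of size \<open>T\<close>: a subset with no clique of
  size \<open>L\<close> meets each of them in at most \<open>L\<close> vertices. The form without
  division is additive over disjoint unions and admits the empty set.\<close>

definition clique_dense :: "nat \<Rightarrow> nat \<Rightarrow> 'a set \<Rightarrow> 'a set set \<Rightarrow> bool" where
  "clique_dense L T A E \<longleftrightarrow>
    (\<forall>Y\<subseteq>A. (\<forall>Q\<subseteq>Y. clique Q E \<longrightarrow> card Q \<noteq> L) \<longrightarrow> T * card Y \<le> L * card A)"

lemma clique_dense_empty [simp]: "clique_dense L T {} E"
  by (simp add: clique_dense_def)

lemma clique_dense_clique:
  assumes "clique A E" "card A = T"
  shows "clique_dense L T A E"
  unfolding clique_dense_def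
proof (intro allI impI)
  fix Y assume Y: "Y \<subseteq> A" "\<forall>Q\<subseteq>Y. clique Q E \<longrightarrow> card Q \<noteq> L"
  have "card Y \<le> L"
  proof (rule ccontr)
    assume "\<not> card Y \<le> L"
    then obtain Q where "Q \<subseteq> Y" "card Q = L"
      by (metis nat_le_linear obtain_subset_with_card_n)
    then show False using Y assms(1) smaller_clique by (metis subset_trans)
  qed
  then show "T * card Y \<le> L * card A" using assms(2) by simp
qed

lemma clique_dense_Un:
  assumes "clique_dense L T A E" "clique_dense L T B E" "finite A" "finite B" "A \<inter> B = {}"
  shows "clique_dense L T (A \<union> B) E"
  unfolding clique_dense_def
proof (intro allI impI)
  fix Y assume Y: "Y \<subseteq> A \<union> B" "\<forall>Q\<subseteq>Y. clique Q E \<longrightarrow> card Q \<noteq> L"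
  have "T * card (Y \<inter> A) \<le> L * card A" "T * card (Y \<inter> B) \<le> L * card B"
    using assms(1,2) Y(2) unfolding clique_dense_def by (meson Int_lower1 Int_lower2 subset_trans)+
  moreover have "card Y = card (Y \<inter> A) + card (Y \<inter> B)"
    using Y(1) assms(3-5) by (subst card_Un_disjoint[symmetric]) (auto intro: arg_cong[where f = card])
  moreover have "card (A \<union> B) = card A + card B"
    using assms(3-5) by (rule card_Un_disjoint)
  ultimately show "T * card Y \<le> L * card (A \<union> B)" by (simp add: add_mult_distrib2)
qed

text \<open>Monochromatic cliques of size \<open>T\<close> are removed greedily and collected by
  colour. By Ramsey's theorem this goes on until fewer than \<open>N\<close> vertices are left, and
  \<open>N\<close> does not depend on \<open>A\<close>.\<close>

lemma Ramsey_clique_dense_cover: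
  assumes "T \<ge> 1"
  shows "\<exists>N. \<forall>(A :: 'a set) E. finite A \<longrightarrow> (\<exists>A1 A2. A1 \<subseteq> A \<and> A2 \<subseteq> A \<and>
    card A \<le> card A1 + card A2 + N \<and> clique_dense L T A1 E \<and> clique_dense L T A2 (- E))"
proof -
  obtain N where N: "\<And>(V :: 'a set) E. finite V \<Longrightarrow> N \<le> card V \<Longrightarrow>
    \<exists>R\<subseteq>V. card R = T \<and> clique R E \<or> card R = T \<and> indep R E"
    using ramsey2[of T T, where 'a = 'a] by (metis (no_types, lifting))
  have "\<exists>A1 A2. A1 \<subseteq> A \<and> A2 \<subseteq> A \<and> card A \<le> card A1 + card A2 + N \<and>
      clique_dense L T A1 E \<and> clique_dense L T A2 (- E)"
    if "finite A" for A :: "'a set" and E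
    using that
  proof (induction A rule: finite_psubset_induct)
    case (psubset A)
    show ?case
    proof (cases "N \<le> card A")
      case False
      then show ?thesis by (intro exI[of _ "{}"]) auto
    next
      case True
      obtain R where R: "R \<subseteq> A" "card R = T" and RE: "clique R E \<or> clique R (- E)"
        using N[OF psubset.hyps True, of E] by (auto simp: indep_def clique_def)
      have "finite R" using R psubset.hyps finite_subset by blast
      have "R \<noteq> {}" using R assms by auto
      then have less: "A - R \<subset> A" using R by blast
      obtain A1 A2 where A12: "A1 \<subseteq> A - R" "A2 \<subseteq> A - R"
        and c: "card (A - R) \<le> card A1 + card A2 + N"
        and d: "clique_dense L T A1 E" "clique_dense L T A2 (- E)"
        using psubset.IH[OF less] by metis
      have fin: "finite A1" "finite A2" using A12 psubset.hyps finite_subset by blast+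
      have cA: "card A = card (A - R) + card R"
        using R psubset.hyps \<open>finite R\<close> card_mono[of A R] by (simp add: card_Diff_subset)
      have cR: "card (A' \<union> R) = card A' + card R" "A' \<inter> R = {}" "A' \<union> R \<subseteq> A"
        if "A' \<subseteq> A - R" for A'
        using that R \<open>finite R\<close> psubset.hyps
        by (auto intro!: card_Un_disjoint intro: finite_subset)
      from RE show ?thesis
      proof
        assume "clique R E"
        then have "clique_dense L T (A1 \<union> R) E"
          using clique_dense_Un[OF d(1) clique_dense_clique fin(1) \<open>finite R\<close> cR(2)[OF A12(1)]] R(2) by blast
        then show ?thesis
          using cA c d(2) cR[OF A12(1)] A12(2) by (intro exI[of _ "A1 \<union> R"] exI[of _ A2]) auto
      next
        assume "clique R (- E)"
        then have "clique_dense L T (A2 \<union> R) (- E)"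
          using clique_dense_Un[OF d(2) clique_dense_clique fin(2) \<open>finite R\<close> cR(2)[OF A12(2)]] R(2) by blast
        then show ?thesis
          using cA c d(1) cR[OF A12(2)] A12(1) by (intro exI[of _ A1] exI[of _ "A2 \<union> R"]) auto
      qed
    qed
  qed
  then show ?thesis by blast
qed

section \<open>Averaging over the pages\<close>

text \<open>The Weierstrass product inequality: the remaining product is at most 1, so a further
  factor \<open>1 - d i\<close> lowers it by at most \<open>d i\<close>.\<close>

lemma prod_one_minus_ge:
  fixes d :: "'i \<Rightarrow> real"
  assumes "finite I" "\<And>i. i \<in> I \<Longrightarrow> 0 \<le> d i \<and> d i \<le> 1"
  shows "1 - (\<Sum>i\<in>I. d i) \<le> (\<Prod>i\<in>I. 1 - d i)"
  using assms
proof (induction I rule: finite_induct)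
  case (insert i I)
  have p: "0 \<le> (\<Prod>i\<in>I. 1 - d i)" "(\<Prod>i\<in>I. 1 - d i) \<le> 1"
    using insert.prems by (auto intro!: prod_nonneg prod_le_1)
  have "d i * (\<Prod>i\<in>I. 1 - d i) \<le> d i * 1"
    using insert.prems p by (intro mult_left_mono) auto
  moreover have "1 - (\<Sum>i\<in>I. d i) \<le> (\<Prod>i\<in>I. 1 - d i)" using insert by auto
  ultimately have "1 - (d i + (\<Sum>i\<in>I. d i)) \<le> (1 - d i) * (\<Prod>i\<in>I. 1 - d i)"
    by (simp add: algebra_simps)
  then show ?case using insert by simp
qed simp

text \<open>With \<open>x i\<close> and \<open>1 - x i\<close> the two colour densities of a vertex towards the \<open>i\<close>-th clique, \<open>z i\<close>
  stands for \<open>(1 - x i)^k\<close>, of which only Bernoulli's lower bound is needed.\<close>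

lemma prod_plus_average_ge:
  fixes x z :: "nat \<Rightarrow> real"
  assumes k: "k \<ge> 1"
    and x: "\<And>i. i < k \<Longrightarrow> 0 \<le> x i \<and> x i \<le> 1"
    and z: "\<And>i. i < k \<Longrightarrow> 0 \<le> z i" "\<And>i. i < k \<Longrightarrow> real k * (1 - 2 * x i) / 2 ^ k \<le> z i"
  shows "1 / 2 ^ k \<le> (\<Prod>i<k. x i) + (\<Sum>i<k. z i) / real k"
proof -
  \<comment> \<open>\<open>d i\<close> is twice the deficit of \<open>x i\<close> below 1/2,
    truncated at 0. The product loses at most the sum of the \<open>d i\<close> over
    \<open>2^k\<close>, and the average of the \<open>z i\<close> gains at least as much.\<close>
  define d where "d i = max 0 (1 - 2 * x i)" for i
  have d: "0 \<le> d i \<and> d i \<le> 1" if "i < k" for i using x[OF that] by (auto simp: d_def)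
  have "(1 - (\<Sum>i<k. d i)) / 2 ^ k \<le> (\<Prod>i<k. 1 - d i) / 2 ^ k"
    using prod_one_minus_ge[of "{..<k}" d] d by (intro divide_right_mono) auto
  also have "\<dots> = (\<Prod>i<k. (1 - d i) / 2)" by (simp add: prod_dividef)
  also have "\<dots> \<le> (\<Prod>i<k. x i)"
    using d x by (intro prod_mono) (auto simp: d_def max_def)
  finally have 1: "(1 - (\<Sum>i<k. d i)) / 2 ^ k \<le> (\<Prod>i<k. x i)" .
  have "(\<Sum>i<k. real k * d i / 2 ^ k) \<le> (\<Sum>i<k. z i)"
    using z by (intro sum_mono) (auto simp: d_def max_def)
  then have "real k * ((\<Sum>i<k. d i) / 2 ^ k) \<le> (\<Sum>i<k. z i)"
    by (simp add: sum_distrib_left sum_divide_distrib)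
  then have 2: "(\<Sum>i<k. d i) / 2 ^ k \<le> (\<Sum>i<k. z i) / real k"
    using k by (simp add: field_simps)
  have "1 / 2 ^ k = (1 - (\<Sum>i<k. d i)) / 2 ^ k + (\<Sum>i<k. d i) / 2 ^ k"
    by (simp add: diff_divide_distrib)
  then show ?thesis using 1 2 by linarith
qed

text \<open>For \<open>2 * a \<le> s\<close> the left side is not positive. Otherwise
  \<open>binomial_ratio\<close> bounds the right side below by
  \<open>((1 + \<sigma> - 2k/s) / 2)^k\<close>, and Bernoulli's inequality applies. The choice of
  \<open>s\<close> makes the error \<open>2 * k^2 / s\<close> equal to 1/2, which the leading 1
  absorbs.\<close>

lemma binomial_ratio_ge_linear:
  assumes k: "k \<ge> 1" and s: "s = 4 * k\<^sup>2" and a: "a \<le> s"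
  shows "real k * (1 - 2 * (real (s - a) / real s)) / 2 ^ k \<le> real (a choose k) / real (s choose k)"
proof (cases "2 * a \<le> s")
  case True
  have "s > 0" using k s by simp
  then have "1 - 2 * (real (s - a) / real s) \<le> 0" using True a by (simp add: field_simps of_nat_diff)
  then have "real k * (1 - 2 * (real (s - a) / real s)) / 2 ^ k \<le> 0"
    by (intro divide_nonpos_pos mult_nonneg_nonpos) (assumption | simp)+
  also have "0 \<le> real (a choose k) / real (s choose k)" by simp
  finally show ?thesis .
next
  case False
  define \<sigma> where "\<sigma> = 1 - 2 * (real (s - a) / real s)"
  have kk: "k \<le> k\<^sup>2" using k by (simp add: power2_eq_square)
  have s0: "s > 0" using k s by simp
  have pos: "real (s choose k) > 0" using s kk by simp
  have \<sigma>: "\<sigma> \<ge> 0" using False a s0 by (simp add: \<sigma>_def field_simps of_nat_diff)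
  have ka: "k \<le> a" using False s kk by linarith
  have "(real a - real k) / real s = (1 + (\<sigma> - 2 * real k / real s)) / 2"
    using s0 a by (simp add: \<sigma>_def field_simps of_nat_diff)
  then have eq: "((real a - real k) / real s) ^ k = (1 + (\<sigma> - 2 * real k / real s)) ^ k / 2 ^ k"
    by (simp only: power_divide)
  have ks: "2 * real k / real s \<le> 1" "real k * (2 * real k / real s) \<le> 1"
    using k s kk by (auto simp: field_simps power2_eq_square)
  have "real k * \<sigma> \<le> 1 + real k * (\<sigma> - 2 * real k / real s)"
    using ks(2) by (simp add: right_diff_distrib)
  also have "\<dots> \<le> (1 + (\<sigma> - 2 * real k / real s)) ^ k"
    using \<sigma> ks(1) by (intro Bernoulli_inequality) linarith
  finally have "real k * \<sigma> / 2 ^ k \<le> ((real a - real k) / real s) ^ k"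
    unfolding eq by (intro divide_right_mono) auto
  moreover have "((real a - real k) / real s) ^ k * real (s choose k) \<le> real (a choose k)"
    using ka a s0 by (intro binomial_ratio)
  then have "((real a - real k) / real s) ^ k \<le> real (a choose k) / real (s choose k)"
    using pos by (simp add: pos_le_divide_eq)
  ultimately show ?thesis unfolding \<sigma>_def by linarith
qed

text \<open>Double counting of the pairs of a transversal of the \<open>k\<close> cliques and a
  vertex \<open>b\<close> joined to it in the colour \<open>- E\<close>. Each of the
  \<open>s^k\<close> transversals is a clique in that colour and so has at most \<open>n\<close>
  such vertices \<open>b\<close>.\<close>

lemma sum_prod_non_neighbours_le:
  assumes sep: "separated_cliques k s A E Q" and fin: "finite A" "finite B"
    and nobook: "\<And>K. K \<subseteq> A \<Longrightarrow> card K = k \<Longrightarrow> clique K (- E) \<Longrightarrow>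
      card {b \<in> B. \<forall>u\<in>K. {u, b} \<in> - E} \<le> n"
  shows "(\<Sum>b\<in>B. \<Prod>i<k. card {u \<in> Q i. {u, b} \<notin> E}) \<le> n * s ^ k"
proof -
  have Q: "Q i \<subseteq> A" "card (Q i) = s" if "i < k" for i
    using sep that by (auto simp: separated_cliques_def)
  have cross: "u \<noteq> v \<and> {u, v} \<notin> E" if "i < k" "j < k" "i \<noteq> j" "u \<in> Q i" "v \<in> Q j" for i j u v
    using sep that unfolding separated_cliques_def by (metis insert_commute linorder_neqE_nat)
  have finQ: "finite (Q i)" if "i < k" for i using Q[OF that] fin finite_subset by blast
  define P where "P = (\<Pi>\<^sub>E i\<in>{..<k}. Q i)"
  have finP: "finite P" unfolding P_def using finQ by (intro finite_PiE) auto
  have cP: "card P = s ^ k" unfolding P_def using Q by (simp add: card_PiE)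
  have "(\<Sum>b\<in>B. \<Prod>i<k. card {u \<in> Q i. {u, b} \<notin> E})
      = (\<Sum>b\<in>B. card (\<Pi>\<^sub>E i\<in>{..<k}. {u \<in> Q i. {u, b} \<notin> E}))"
    by (simp add: card_PiE)
  also have "\<dots> = (\<Sum>b\<in>B. \<Sum>f\<in>P. of_bool (\<forall>i<k. {f i, b} \<notin> E))"
    using finP by (intro sum.cong refl) (auto simp: P_def PiE_def Pi_def intro!: arg_cong[where f = card])
  also have "\<dots> = (\<Sum>f\<in>P. \<Sum>b\<in>B. of_bool (\<forall>i<k. {f i, b} \<notin> E))" by (rule sum.swap)
  also have "\<dots> \<le> (\<Sum>f\<in>P. n)"
  proof (rule sum_mono)
    fix f assume f: "f \<in> P"
    have fQ: "f i \<in> Q i" if "i < k" for i using f that by (auto simp: P_def)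
    define K where "K = f ` {..<k}"
    have "inj_on f {..<k}"
      by (rule inj_onI) (metis cross fQ lessThan_iff)
    then have "card K = k" by (simp add: K_def card_image)
    moreover have "clique K (- E)"
    proof -
      have "{f i, f j} \<notin> E" if "i < k" "j < k" "f i \<noteq> f j" for i j
        using cross[OF that(1,2) _ fQ[OF that(1)] fQ[OF that(2)]] that(3) by metis
      then show ?thesis unfolding K_def clique_def by auto
    qed
    moreover have "K \<subseteq> A" using fQ Q by (auto simp: K_def)
    ultimately have "card {b \<in> B. \<forall>u\<in>K. {u, b} \<in> - E} \<le> n" using nobook by blast
    moreover have "B \<inter> {b. \<forall>i<k. {f i, b} \<notin> E} = {b \<in> B. \<forall>u\<in>K. {u, b} \<in> - E}"
      by (auto simp: K_def)
    ultimately show "(\<Sum>b\<in>B. of_bool (\<forall>i<k. {f i, b} \<notin> E)) \<le> n"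
      using fin by simp
  qed
  finally show ?thesis by (simp add: cP mult.commute)
qed

text \<open>For \<open>b\<close> in \<open>B\<close>, \<open>prod_plus_average_ge\<close> is applied
  with \<open>x i\<close> the proportion of non-neighbours of \<open>b\<close> in \<open>Q i\<close>
  and \<open>z i\<close> the proportion of \<open>k\<close>-subsets of \<open>Q i\<close> inside its
  neighbourhood. Summed over \<open>B\<close>, the products average over transversal spines and the
  \<open>z i\<close> over spines inside \<open>Q i\<close>; either part is at most
  \<open>n\<close>.\<close>

lemma card_pages_le:
  assumes k: "k \<ge> 1" and sep: "separated_cliques k (4 * k\<^sup>2) A E Q"
    and fin: "finite A" "finite B"
    and nobook: "\<And>K E'. E' \<in> {E, - E} \<Longrightarrow> K \<subseteq> A \<Longrightarrow> card K = k \<Longrightarrow> clique K E' \<Longrightarrow>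
      card {b \<in> B. \<forall>u\<in>K. {u, b} \<in> E'} \<le> n"
  shows "card B \<le> 2 ^ (k + 1) * n"
proof -
  define s where "s = 4 * k\<^sup>2"
  have kk: "k \<le> k\<^sup>2" using k by (simp add: power2_eq_square)
  have s0: "s > 0" using k s_def by simp
  have pos: "real (s choose k) > 0" using s_def kk by simp
  have Q: "Q i \<subseteq> A" "card (Q i) = s" "clique (Q i) E" if "i < k" for i
    using sep that by (auto simp: separated_cliques_def s_def)
  have finQ: "finite (Q i)" if "i < k" for i using Q(1)[OF that] fin finite_subset by blast
  define N where "N i b = card {u \<in> Q i. {u, b} \<in> E}" for i b
  define M where "M i b = card {u \<in> Q i. {u, b} \<notin> E}" for i b
  have NM: "M i b = s - N i b" "N i b \<le> s" if "i < k" for i b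
  proof -
    have "N i b + M i b = card ({u \<in> Q i. {u, b} \<in> E} \<union> {u \<in> Q i. {u, b} \<notin> E})"
      unfolding N_def M_def using finQ[OF that] by (intro card_Un_disjoint[symmetric]) auto
    also have "{u \<in> Q i. {u, b} \<in> E} \<union> {u \<in> Q i. {u, b} \<notin> E} = Q i" by auto
    finally show "M i b = s - N i b" "N i b \<le> s" using Q(2)[OF that] by auto
  qed
  have "(\<Sum>b\<in>B. \<Prod>i<k. M i b) \<le> n * s ^ k"
    unfolding M_def
    using sep nobook[of "- E"] by (intro sum_prod_non_neighbours_le[OF _ fin]) (simp_all add: s_def)
  then have "real (\<Sum>b\<in>B. \<Prod>i<k. M i b) \<le> real (n * s ^ k)" by (rule of_nat_mono)
  then have 1: "(\<Sum>b\<in>B. \<Prod>i<k. real (M i b) / real s) \<le> real n"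
    using s0 by (simp add: prod_dividef sum_divide_distrib[symmetric] field_simps)
  have 2: "(\<Sum>b\<in>B. real (N i b choose k) / real (s choose k)) \<le> real n" if i: "i < k" for i
  proof -
    have "(\<Sum>b\<in>B. N i b choose k) \<le> n * (card (Q i) choose k)"
      unfolding N_def
    proof (rule sum_binomial_le[OF finQ[OF i] fin(2)])
      fix S assume S: "S \<subseteq> Q i" "card S = k"
      have "{b \<in> B. S \<subseteq> {u \<in> Q i. {u, b} \<in> E}} = {b \<in> B. \<forall>u\<in>S. {u, b} \<in> E}"
        using S by auto
      then show "card {b \<in> B. S \<subseteq> {u \<in> Q i. {u, b} \<in> E}} \<le> n"
        using nobook[of E S] S Q[OF i] smaller_clique[of "Q i" E S] by auto
    qed auto
    then have "real (\<Sum>b\<in>B. N i b choose k) \<le> real (n * (card (Q i) choose k))" by (rule of_nat_mono)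
    then show ?thesis using pos Q(2)[OF i]
      by (simp add: sum_divide_distrib[symmetric] field_simps)
  qed
  have "real (card B) * (1 / 2 ^ k) = (\<Sum>b\<in>B. 1 / 2 ^ k)" by simp
  also have "\<dots> \<le> (\<Sum>b\<in>B. (\<Prod>i<k. real (M i b) / real s)
      + (\<Sum>i<k. real (N i b choose k) / real (s choose k)) / real k)"
  proof (rule sum_mono, rule prod_plus_average_ge[OF k])
    fix b i assume i: "i < k"
    show "0 \<le> real (M i b) / real s \<and> real (M i b) / real s \<le> 1"
      using NM[OF i] s0 by simp
    show "real k * (1 - 2 * (real (M i b) / real s)) / 2 ^ k \<le> real (N i b choose k) / real (s choose k)"
      unfolding NM(1)[OF i] by (rule binomial_ratio_ge_linear[OF k s_def NM(2)[OF i]])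
  qed simp
  also have "\<dots> = (\<Sum>b\<in>B. \<Prod>i<k. real (M i b) / real s)
      + (\<Sum>b\<in>B. \<Sum>i<k. real (N i b choose k) / real (s choose k)) / real k"
    by (simp add: sum.distrib sum_divide_distrib)
  also have "(\<Sum>b\<in>B. \<Sum>i<k. real (N i b choose k) / real (s choose k))
      = (\<Sum>i<k. \<Sum>b\<in>B. real (N i b choose k) / real (s choose k))"
    by (rule sum.swap)
  also have "(\<Sum>i<k. \<Sum>b\<in>B. real (N i b choose k) / real (s choose k)) / real k \<le> (\<Sum>i<k. real n) / real k"
    using 2 by (intro divide_right_mono sum_mono) auto
  also have "(\<Sum>i<k. real n) / real k = real n" using k by simp
  finally have "real (card B) * (1 / 2 ^ k) \<le> 2 * real n" using 1 by linarith
  then have "real (card B) \<le> 2 ^ (k + 1) * real n" by (simp add: field_simps)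
  also have "\<dots> = real (2 ^ (k + 1) * n)" by simp
  finally show ?thesis by (simp only: of_nat_le_iff)
qed

text \<open>One of the two parts of \<open>A\<close> covered by cliques of one colour has at least
  \<open>4 * k * n\<close> vertices. Without a book it would be clique rich, hence contain
  \<open>k\<close> separated cliques, and \<open>card_pages_le\<close> would contradict the size of
  \<open>B\<close>. The argument is symmetric in \<open>E\<close> and \<open>- E\<close>.\<close>

lemma exists_mono_book:
  assumes k: "k \<ge> 1"
  shows "\<exists>n0. \<forall>n\<ge>n0. \<forall>(A :: 'a set) B E. finite A \<longrightarrow> finite B \<longrightarrow> A \<inter> B = {} \<longrightarrow>
    9 * k * n \<le> card A \<longrightarrow> 2 ^ (k + 1) * n < card B \<longrightarrow>
    (\<exists>E'\<in>{E, - E}. \<exists>K\<subseteq>A. card K = k \<and> clique K E' \<and>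
       n \<le> card {v \<in> A \<union> B - K. \<forall>u\<in>K. {u, v} \<in> E'})"
proof -
  obtain L where L: "L \<ge> 1"
    and sep: "\<And>(A :: 'a set) E n. clique_rich k n L A E \<Longrightarrow> \<exists>Q. separated_cliques k (4 * k\<^sup>2) A E Q"
    using clique_rich_imp_separated_cliques[OF k order_refl, of "4 * k\<^sup>2"] by blast
  \<comment> \<open>With \<open>T > L^2\<close>, a set \<open>X\<close> of density at least
    \<open>1 / L\<close> without a clique of size \<open>L\<close> would satisfy
    \<open>T * card X \<le> L^2 * card X\<close> and be empty.\<close>
  define T where "T = L * L + 1"
  obtain N where N: "\<And>(A :: 'a set) E. finite A \<Longrightarrow> \<exists>A1 A2. A1 \<subseteq> A \<and> A2 \<subseteq> A \<and>
    card A \<le> card A1 + card A2 + N \<and> clique_dense L T A1 E \<and> clique_dense L T A2 (- E)"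
    using Ramsey_clique_dense_cover[of T L, where 'a = 'a] unfolding T_def by (metis le_add2)
  have no: False
    if n: "n \<ge> L + N" and fin: "finite A" "finite B" and disj: "A \<inter> B = {}"
      and A0: "A0 \<subseteq> A" "4 * k * n \<le> card A0" "clique_dense L T A0 E"
      and cB: "2 ^ (k + 1) * n < card B"
      and nobook: "\<And>K E'. E' \<in> {E, - E} \<Longrightarrow> K \<subseteq> A \<Longrightarrow> card K = k \<Longrightarrow> clique K E' \<Longrightarrow>
        card {v \<in> A \<union> B - K. \<forall>u\<in>K. {u, v} \<in> E'} \<le> n"
    for n and A B A0 :: "'a set" and E
  proof -
    have finA0: "finite A0" using A0 fin finite_subset by blast
    have "card A0 > 0" using A0(2) k n L by (intro less_le_trans[OF _ A0(2)]) auto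
    have sub: "card {v \<in> X. \<forall>u\<in>K. {u, v} \<in> E'} \<le> n"
      if "X \<subseteq> A \<union> B - K" "E' \<in> {E, - E}" "K \<subseteq> A" "card K = k" "clique K E'" for X K E'
    proof -
      have "card {v \<in> X. \<forall>u\<in>K. {u, v} \<in> E'} \<le> card {v \<in> A \<union> B - K. \<forall>u\<in>K. {u, v} \<in> E'}"
        using that(1) fin by (intro card_mono) auto
      then show ?thesis using nobook[OF that(2-5)] by linarith
    qed
    have "clique_rich k n L A0 E"
      unfolding clique_rich_def
    proof (intro conjI allI impI)
      fix X assume X: "X \<subseteq> A0" "card A0 \<le> L * card X"
      show "\<exists>Q\<subseteq>X. card Q = L \<and> clique Q E"
      proof (rule ccontr)
        assume "\<not> (\<exists>Q\<subseteq>X. card Q = L \<and> clique Q E)"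
        then have "T * card X \<le> L * card A0"
          using A0(3) X(1) unfolding clique_dense_def by blast
        also have "\<dots> \<le> L * (L * card X)" using X(2) by (rule mult_le_mono2)
        finally have "card X = 0" by (simp add: T_def mult.assoc)
        then show False using X(2) \<open>card A0 > 0\<close> by simp
      qed
    next
      fix Q assume Q: "Q \<subseteq> A0" "clique Q E" "4 * k\<^sup>2 \<le> card Q"
      show "card {w \<in> A0 - Q. 4 * k * card {u \<in> Q. {u, w} \<notin> E} < card Q} \<le> 2 * n"
      proof (rule card_few_non_neighbours_le[OF _ _ k Q(3)])
        fix S assume S: "S \<subseteq> Q" "card S = k"
        show "card {w \<in> A0 - Q. \<forall>u\<in>S. {u, w} \<in> E} \<le> n"
          using S Q A0(1) smaller_clique[OF Q(2) S(1)] by (intro sub) auto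
      qed (use finA0 Q finite_subset in auto)
    qed (use finA0 n A0 in auto)
    then obtain Q where Q: "separated_cliques k (4 * k\<^sup>2) A0 E Q" using sep by blast
    have pages: "card {b \<in> B. \<forall>u\<in>K. {u, b} \<in> E'} \<le> n"
      if "E' \<in> {E, - E}" "K \<subseteq> A0" "card K = k" "clique K E'" for K E'
      using that A0(1) disj by (intro sub) blast+
    have "card B \<le> 2 ^ (k + 1) * n"
      by (rule card_pages_le[OF k Q finA0 fin(2) pages])
    then show False using cB by simp
  qed
  show ?thesis
  proof (intro exI[of _ "L + N"] allI impI)
    fix n and A B :: "'a set" and E
    assume n: "L + N \<le> n" and fin: "finite A" "finite B" and disj: "A \<inter> B = {}"
      and cA: "9 * k * n \<le> card A" and cB: "2 ^ (k + 1) * n < card B"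
    show "\<exists>E'\<in>{E, - E}. \<exists>K\<subseteq>A. card K = k \<and> clique K E' \<and>
       n \<le> card {v \<in> A \<union> B - K. \<forall>u\<in>K. {u, v} \<in> E'}"
    proof (rule ccontr)
      assume neg: "\<not> ?thesis"
      have nobook: "card {v \<in> A \<union> B - K. \<forall>u\<in>K. {u, v} \<in> E'} \<le> n"
        if "E' \<in> {E, - E}" "K \<subseteq> A" "card K = k" "clique K E'" for K E'
      proof -
        have "\<not> n \<le> card {v \<in> A \<union> B - K. \<forall>u\<in>K. {u, v} \<in> E'}"
          using neg that by blast
        then show ?thesis by simp
      qed
      obtain A1 A2 where A12: "A1 \<subseteq> A" "A2 \<subseteq> A" "card A \<le> card A1 + card A2 + N"
        and d: "clique_dense L T A1 E" "clique_dense L T A2 (- E)"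
        using N[OF fin(1)] by blast
      \<comment> \<open>At least \<open>9kn - N \<ge> 8kn\<close> vertices are covered, so one part
        gets half of that.\<close>
      have "N \<le> n" "n \<le> k * n" using n k by simp_all
      then have "4 * k * n \<le> card A1 \<or> 4 * k * n \<le> card A2"
        using cA A12(3) by linarith
      then show False
      proof
        assume "4 * k * n \<le> card A1"
        then show False by (rule no[OF n fin disj A12(1) _ d(1) cB nobook])
      next
        assume "4 * k * n \<le> card A2"
        moreover have "card {v \<in> A \<union> B - K. \<forall>u\<in>K. {u, v} \<in> E'} \<le> n"
          if "E' \<in> {- E, - (- E)}" "K \<subseteq> A" "card K = k" "clique K E'" for K E'
          using nobook[OF _ that(2-4)] that(1) by auto
        ultimately show False by (rule no[OF n fin disj A12(2) _ d(2) cB])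
      qed
    qed
  qed
qed

section \<open>Books as subgraphs, and a graph that is Ramsey for a book\<close>

lemma edges_book: "edges (book k n) = {{i, j} | i j. i < k \<and> j < k + n \<and> i \<noteq> j}"
proof -
  have "[{..<k}]\<^bsup>2\<^esup> = {{i, j} | i j. i < k \<and> j < k \<and> i \<noteq> j}"
    by (auto simp: nsets_2_eq)
  moreover have "{{i, j} | i j. i < k \<and> j < k + n \<and> i \<noteq> j}
      = {{i, j} | i j. i < k \<and> j < k \<and> i \<noteq> j} \<union> {{u, v} | u v. u \<in> {..<k} \<and> v \<in> {k..<k + n}}"
    (is "?L = ?R")
  proof
    show "?L \<subseteq> ?R"
    proof
      fix x assume "x \<in> ?L"
      then obtain i j where x: "x = {i, j}" "i < k" "j < k + n" "i \<noteq> j" by blast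
      show "x \<in> ?R"
      proof (cases "j < k")
        case True
        then show ?thesis using x by blast
      next
        case False
        then have "i \<in> {..<k} \<and> j \<in> {k..<k + n}" using x by simp
        then show ?thesis using x(1) by blast
      qed
    qed
    show "?R \<subseteq> ?L" by fastforce
  qed
  ultimately show ?thesis unfolding book_def by simp
qed

lemma verts_book: "verts (book k n) = {..<k + n}"
  by (auto simp: book_def)

lemma copy_of_bookD:
  assumes F: "copy_of F (book k n) G"
  shows "\<exists>K P. K \<subseteq> verts G \<and> P \<subseteq> verts G \<and> K \<inter> P = {} \<and> card K = k \<and> card P = n \<and>
    (\<forall>u\<in>K. \<forall>v\<in>K \<union> P. u \<noteq> v \<longrightarrow> {u, v} \<in> edges F)"
proof -
  obtain f where f: "bij_betw f (verts F) {..<k + n}"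
    and e: "edges (book k n) = (\<lambda>e. f ` e) ` edges F"
    using F unfolding copy_of_def isomorphic_def verts_book by blast
  have sub: "verts F \<subseteq> verts G" "\<And>e. e \<in> edges F \<Longrightarrow> e \<subseteq> verts F"
    using F unfolding copy_of_def subgraph_def finite_simple_graph_def nsets_def by blast+
  have inj: "inj_on f (verts F)" and im: "f ` verts F = {..<k + n}"
    using f by (auto simp: bij_betw_def)
  define K where "K = {v \<in> verts F. f v < k}"
  define P where "P = {v \<in> verts F. k \<le> f v}"
  have "f ` K = f ` verts F \<inter> {..<k}" unfolding K_def by auto
  then have "f ` K = {..<k}" using im by auto
  moreover have "inj_on f K" using inj by (rule inj_on_subset) (auto simp: K_def)
  ultimately have "card K = k" by (metis card_image card_lessThan)
  have "f ` P = f ` verts F \<inter> {k..}" unfolding P_def by auto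
  then have "f ` P = {k..<k + n}" using im by auto
  moreover have "inj_on f P" using inj by (rule inj_on_subset) (auto simp: P_def)
  ultimately have "card P = n" by (metis card_image card_atLeastLessThan diff_add_inverse)
  have "{u, v} \<in> edges F" if uv: "u \<in> K" "v \<in> K \<union> P" "u \<noteq> v" for u v
  proof -
    have V: "u \<in> verts F" "v \<in> verts F" using uv by (auto simp: K_def P_def)
    then have "f u < k" "f v < k + n" "f u \<noteq> f v"
      using uv im inj by (auto simp: K_def inj_on_def)
    then have "{f u, f v} \<in> edges (book k n)" unfolding edges_book by blast
    then obtain e' where e': "e' \<in> edges F" "f ` e' = f ` {u, v}" unfolding e by auto
    then have "e' = {u, v}" using inj_on_image_eq_iff[OF inj sub(2)[OF e'(1)], of "{u, v}"] V by simp
    then show ?thesis using e' by simp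
  qed
  moreover have "K \<subseteq> verts G" "P \<subseteq> verts G" "K \<inter> P = {}" using sub by (auto simp: K_def P_def)
  ultimately show ?thesis using \<open>card K = k\<close> \<open>card P = n\<close> by blast
qed

lemma copy_of_bookI:
  assumes fin: "finite K" "finite P" and sub: "K \<subseteq> verts G" "P \<subseteq> verts G" and disj: "K \<inter> P = {}"
    and card: "card K = k" "card P = n"
    and e: "\<And>u v. u \<in> K \<Longrightarrow> v \<in> K \<union> P \<Longrightarrow> u \<noteq> v \<Longrightarrow> {u, v} \<in> edges G"
  shows "copy_of (K \<union> P, {{u, v} | u v. u \<in> K \<and> v \<in> K \<union> P \<and> u \<noteq> v}) (book k n) G"
proof -
  obtain f1 where f1: "bij_betw f1 K {..<k}"
    using finite_same_card_bij[OF fin(1), of "{..<k}"] card by auto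
  obtain f2 where f2: "bij_betw f2 P {k..<k + n}"
    using finite_same_card_bij[OF fin(2), of "{k..<k + n}"] card by auto
  define f where "f v = (if v \<in> K then f1 v else f2 v)" for v
  have bK: "bij_betw f K {..<k}" using f1 by (rule bij_betw_cong[THEN iffD1, rotated]) (simp add: f_def)
  have bP: "bij_betw f P {k..<k + n}"
    using f2 by (rule bij_betw_cong[THEN iffD1, rotated]) (use disj in \<open>auto simp: f_def\<close>)
  have un: "{..<k} \<union> {k..<k + n} = {..<k + n}" by auto
  have b: "bij_betw f (K \<union> P) {..<k + n}"
    using bij_betw_combine[OF bK bP ivl_disj_int_one(2)] unfolding un .
  have "edges (book k n) = (\<lambda>e. f ` e) ` {{u, v} | u v. u \<in> K \<and> v \<in> K \<union> P \<and> u \<noteq> v}"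
    unfolding edges_book
  proof (intro equalityI subsetI)
    fix x assume "x \<in> {{i, j} | i j. i < k \<and> j < k + n \<and> i \<noteq> j}"
    then obtain i j where ij: "x = {i, j}" "i < k" "j < k + n" "i \<noteq> j" by blast
    obtain u where "u \<in> K" "f u = i" using ij bK by (metis bij_betw_iff_bijections lessThan_iff)
    moreover obtain v where "v \<in> K \<union> P" "f v = j"
      using ij b by (metis bij_betw_iff_bijections lessThan_iff)
    ultimately show "x \<in> (\<lambda>e. f ` e) ` {{u, v} | u v. u \<in> K \<and> v \<in> K \<union> P \<and> u \<noteq> v}"
      using ij by (intro image_eqI[of _ _ "{u, v}"]) auto
  next
    fix x assume "x \<in> (\<lambda>e. f ` e) ` {{u, v} | u v. u \<in> K \<and> v \<in> K \<union> P \<and> u \<noteq> v}"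
    then obtain u v where uv: "x = {f u, f v}" "u \<in> K" "v \<in> K \<union> P" "u \<noteq> v" by auto
    have "f u < k" using bK uv(2) by (auto simp: bij_betw_def)
    moreover have "f v < k + n" using b uv(3) by (auto simp: bij_betw_def)
    moreover have "f u \<noteq> f v" using b uv unfolding bij_betw_def inj_on_def by blast
    ultimately show "x \<in> {{i, j} | i j. i < k \<and> j < k + n \<and> i \<noteq> j}" using uv by blast
  qed
  moreover have "finite_simple_graph (K \<union> P, {{u, v} | u v. u \<in> K \<and> v \<in> K \<union> P \<and> u \<noteq> v})"
    unfolding finite_simple_graph_def using fin by (auto simp: nsets_2_eq)
  ultimately show ?thesis
    using sub b e unfolding copy_of_def subgraph_def isomorphic_def verts_book by auto
qed

text \<open>The graph is the join of a clique on \<open>a = 9kn\<close> vertices with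
  \<open>b\<close> independent ones, so it has at most \<open>a * (a + b)\<close> edges. From
  \<open>k \<le> 2^k\<close> follows \<open>a + b \<le> 13 * 2^k * n\<close>, and 117 is 9 times
  13.\<close>

lemma exists_Ramsey_graph_for_book:
  assumes k: "k \<ge> 1"
  shows "\<exists>n0. \<forall>n\<ge>n0. \<exists>G :: nat graph. finite_simple_graph G \<and> ramsey_for G (book k n) \<and>
    real (card (edges G)) \<le> 117 * real k * 2 ^ k * real n ^ 2"
proof -
  obtain n0 where n0: "\<forall>n\<ge>n0. \<forall>(A :: nat set) B E. finite A \<longrightarrow> finite B \<longrightarrow> A \<inter> B = {} \<longrightarrow>
    9 * k * n \<le> card A \<longrightarrow> 2 ^ (k + 1) * n < card B \<longrightarrow>
    (\<exists>E'\<in>{E, - E}. \<exists>K\<subseteq>A. card K = k \<and> clique K E' \<and>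
       n \<le> card {v \<in> A \<union> B - K. \<forall>u\<in>K. {u, v} \<in> E'})"
    using exists_mono_book[OF k, where 'a = nat] by (elim exE) (rule that)
  show ?thesis
  proof (intro exI[of _ "n0 + 1"] allI impI)
    fix n assume n: "n0 + 1 \<le> n"
    define a where "a = 9 * k * n"
    \<comment> \<open>The summand 1 makes the inequality of \<open>exists_mono_book\<close> strict;
      since \<open>n > 0\<close>, it is at most \<open>2^k * n\<close> in the edge count.\<close>
    define b where "b = 2 ^ (k + 1) * n + 1"
    define E where "E = {{u, v} | u v. u \<in> {..<a} \<and> v \<in> {..<a + b} \<and> u \<noteq> v}"
    define G where "G = ({..<a + b}, E)"
    have simple: "finite_simple_graph G"
      unfolding finite_simple_graph_def G_def E_def by (auto simp: nsets_def)
    have "ramsey_for G (book k n)"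
      unfolding ramsey_for_def
    proof
      fix \<chi> :: "nat set \<Rightarrow> bool"
      have "{..<a} \<inter> {a..<a + b} = {}" by auto
      then have "\<exists>E'\<in>{{e. \<chi> e}, - {e. \<chi> e}}. \<exists>K\<subseteq>{..<a}. card K = k \<and> clique K E' \<and>
          n \<le> card {v \<in> {..<a} \<union> {a..<a + b} - K. \<forall>u\<in>K. {u, v} \<in> E'}"
        using n by (intro n0[rule_format]) (simp_all add: a_def b_def)
      then obtain E' K where E': "E' \<in> {{e. \<chi> e}, - {e. \<chi> e}}" and K: "K \<subseteq> {..<a}" "card K = k" "clique K E'"
        and pages: "n \<le> card {v \<in> {..<a} \<union> {a..<a + b} - K. \<forall>u\<in>K. {u, v} \<in> E'}"
        by blast
      obtain P where P: "P \<subseteq> {v \<in> {..<a} \<union> {a..<a + b} - K. \<forall>u\<in>K. {u, v} \<in> E'}" "card P = n" "finite P"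
        using obtain_subset_with_card_n[OF pages] by blast
      obtain c where c: "\<And>e. e \<in> E' \<Longrightarrow> \<chi> e = c" using E' by auto
      define F where "F = (K \<union> P, {{u, v} | u v. u \<in> K \<and> v \<in> K \<union> P \<and> u \<noteq> v})"
      have "copy_of F (book k n) G"
        unfolding F_def
      proof (rule copy_of_bookI)
        show "finite K" using K finite_subset by blast
        show "K \<subseteq> verts G" "P \<subseteq> verts G" using K P by (auto simp: G_def)
        then show "{u, v} \<in> edges G" if "u \<in> K" "v \<in> K \<union> P" "u \<noteq> v" for u v
        proof -
          have "u \<in> {..<a}" "v \<in> {..<a + b}" using that K P by auto
          then show ?thesis using that(3) unfolding G_def E_def snd_conv by blast
        qed
      qed (use K P in auto)
      moreover have "\<forall>e\<in>edges F. \<chi> e = c"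
        using K(3) P(1) unfolding F_def clique_def by (auto intro!: c)
      ultimately show "\<exists>F. copy_of F (book k n) G \<and> (\<exists>c. \<forall>e\<in>edges F. \<chi> e = c)" by blast
    qed
    moreover have "real (card (edges G)) \<le> 117 * real k * 2 ^ k * real n ^ 2"
    proof -
      have "E \<subseteq> (\<lambda>(u, v). {u, v}) ` ({..<a} \<times> {..<a + b})" by (auto simp: E_def)
      then have "card E \<le> card ({..<a} \<times> {..<a + b})"
        by (intro surj_card_le) auto
      then have "card E \<le> a * (a + b)" by simp
      also have "a + b \<le> 13 * 2 ^ k * n"
      proof -
        have "k * n \<le> 2 ^ k * n" using less_exp[of k] by simp
        moreover have "1 \<le> 2 ^ k * n" using n by simp
        moreover have "a = 9 * (k * n)" "b = 2 * (2 ^ k * n) + 1" by (simp_all add: a_def b_def)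
        ultimately have "a + b \<le> 13 * (2 ^ k * n)" by linarith
        then show ?thesis by (simp only: mult.assoc)
      qed
      then have "a * (a + b) \<le> a * (13 * 2 ^ k * n)" by (rule mult_le_mono2)
      finally have "card E \<le> 117 * k * 2 ^ k * n ^ 2"
        by (simp add: a_def power2_eq_square algebra_simps)
      then have "real (card E) \<le> real (117 * k * 2 ^ k * n ^ 2)" by (rule of_nat_mono)
      then show ?thesis by (simp add: G_def)
    qed
    ultimately show "\<exists>G :: nat graph. finite_simple_graph G \<and> ramsey_for G (book k n) \<and>
      real (card (edges G)) \<le> 117 * real k * 2 ^ k * real n ^ 2" using simple by blast
  qed
qed

section \<open>The lower bound\<close>

text \<open>If \<open>F\<close> is affine at each of finitely many coordinates, \<open>F x\<close>
  is the expected value of \<open>F\<close> when these are replaced by independent 0/1 values with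
  means \<open>x e\<close>. This avoids a probability space.\<close>

definition affine_at :: "'e \<Rightarrow> (('e \<Rightarrow> real) \<Rightarrow> real) \<Rightarrow> bool" where
  "affine_at e F \<longleftrightarrow> (\<forall>x p. F (x(e := p)) = p * F (x(e := 1)) + (1 - p) * F (x(e := 0)))"

definition indep_of :: "'e \<Rightarrow> (('e \<Rightarrow> real) \<Rightarrow> real) \<Rightarrow> bool" where
  "indep_of e F \<longleftrightarrow> (\<forall>x p. F (x(e := p)) = F x)"

lemma indep_of_imp_affine_at: "indep_of e F \<Longrightarrow> affine_at e F"
  by (simp add: indep_of_def affine_at_def algebra_simps)

lemma indep_of_prod: "(\<And>i. i \<in> I \<Longrightarrow> indep_of e (f i)) \<Longrightarrow> indep_of e (\<lambda>x. \<Prod>i\<in>I. f i x)"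
  unfolding indep_of_def by (auto intro: prod.cong)

lemma affine_atI:
  "(\<And>x p. F (x(e := p)) = p * F (x(e := 1)) + (1 - p) * F (x(e := 0))) \<Longrightarrow> affine_at e F"
  unfolding affine_at_def by blast

lemma affine_atD: "affine_at e F \<Longrightarrow> F (x(e := p)) = p * F (x(e := 1)) + (1 - p) * F (x(e := 0))"
  unfolding affine_at_def by blast

lemma affine_at_sum:
  assumes "\<And>i. i \<in> I \<Longrightarrow> affine_at e (f i)"
  shows "affine_at e (\<lambda>x. \<Sum>i\<in>I. f i x)"
proof (rule affine_atI)
  fix x p
  have "(\<Sum>i\<in>I. f i (x(e := p))) = (\<Sum>i\<in>I. p * f i (x(e := 1)) + (1 - p) * f i (x(e := 0)))"
    by (intro sum.cong refl affine_atD assms)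
  then show "(\<Sum>i\<in>I. f i (x(e := p))) = p * (\<Sum>i\<in>I. f i (x(e := 1))) + (1 - p) * (\<Sum>i\<in>I. f i (x(e := 0)))"
    by (simp only: sum.distrib sum_distrib_left)
qed

lemma affine_at_one_plus:
  assumes "affine_at e F"
  shows "affine_at e (\<lambda>x. 1 + F x)"
proof (rule affine_atI)
  fix x p
  show "1 + F (x(e := p)) = p * (1 + F (x(e := 1))) + (1 - p) * (1 + F (x(e := 0)))"
    by (simp only: affine_atD[OF assms, of x p]) (simp add: algebra_simps)
qed

lemma affine_at_mult_indep:
  assumes "affine_at e F" "indep_of e G"
  shows "affine_at e (\<lambda>x. F x * G x)"
proof (rule affine_atI)
  fix x p
  have G: "G (x(e := q)) = G x" for q using assms(2) by (simp add: indep_of_def)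
  then show "F (x(e := p)) * G (x(e := p)) =
      p * (F (x(e := 1)) * G (x(e := 1))) + (1 - p) * (F (x(e := 0)) * G (x(e := 0)))"
    by (simp only: G affine_atD[OF assms(1), of x p]) (simp add: algebra_simps)
qed

text \<open>By the last hypothesis at most one factor depends on \<open>e\<close>; two of them could
  produce a quadratic term.\<close>

lemma affine_at_prod:
  assumes "finite I" "\<And>i. i \<in> I \<Longrightarrow> affine_at e (f i)"
    and "\<And>i j. i \<in> I \<Longrightarrow> j \<in> I \<Longrightarrow> i \<noteq> j \<Longrightarrow> indep_of e (f i) \<or> indep_of e (f j)"
  shows "affine_at e (\<lambda>x. \<Prod>i\<in>I. f i x)"
  using assms
proof (induction I rule: finite_induct)
  case empty
  then show ?case by (simp add: affine_at_def)
next
  case (insert i I)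
  have eq: "(\<lambda>x. \<Prod>j\<in>insert i I. f j x) = (\<lambda>x. f i x * (\<Prod>j\<in>I. f j x))"
    using insert.hyps by simp
  show ?case
  proof (cases "indep_of e (f i)")
    case True
    have "affine_at e (\<lambda>x. \<Prod>j\<in>I. f j x)"
      using insert.IH insert.prems by blast
    then have "affine_at e (\<lambda>x. (\<Prod>j\<in>I. f j x) * f i x)"
      using True by (rule affine_at_mult_indep)
    then show ?thesis unfolding eq by (simp add: mult.commute)
  next
    case False
    have "indep_of e (f j)" if "j \<in> I" for j
      using insert.prems(2)[of i j] insert.hyps that False by auto
    then have "indep_of e (\<lambda>x. \<Prod>j\<in>I. f j x)" by (rule indep_of_prod)
    moreover have "affine_at e (f i)" using insert.prems by blast
    ultimately show ?thesis unfolding eq by (intro affine_at_mult_indep)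
  qed
qed

text \<open>The method of conditional expectations: coordinates are rounded one after the other, and
  since the value at a fractional coordinate is a weighted average of the values at 0 and 1, one of
  these does not exceed it.\<close>

lemma affine_rounding:
  assumes "finite E" "\<And>e. e \<in> E \<Longrightarrow> affine_at e F" "\<And>e. e \<in> E \<Longrightarrow> 0 \<le> x e \<and> x e \<le> 1"
  shows "\<exists>y. (\<forall>e\<in>E. y e = 0 \<or> y e = 1) \<and> (\<forall>e. e \<notin> E \<longrightarrow> y e = x e) \<and> F y \<le> F x"
  using assms
proof (induction E rule: finite_induct)
  case empty
  then show ?case by auto
next
  case (insert e E)
  then obtain y where y: "\<forall>e\<in>E. y e = 0 \<or> y e = 1" "\<forall>e. e \<notin> E \<longrightarrow> y e = x e" "F y \<le> F x"
    by auto
  define p where "p = y e"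
  have p: "0 \<le> p" "p \<le> 1" using insert.prems(2)[of e] y(2) insert.hyps(2) by (auto simp: p_def)
  have "F (y(e := p)) = p * F (y(e := 1)) + (1 - p) * F (y(e := 0))"
    by (intro affine_atD insert.prems) simp
  then have Fy: "F y = p * F (y(e := 1)) + (1 - p) * F (y(e := 0))" by (simp add: p_def)
  obtain q where q: "q = 0 \<or> q = 1" "F (y(e := q)) \<le> F y"
  proof (cases "F (y(e := 1)) \<le> F y")
    case True
    then show ?thesis using that by blast
  next
    case False
    have "F (y(e := 0)) \<le> F y"
    proof (rule ccontr)
      assume "\<not> F (y(e := 0)) \<le> F y"
      then have "p * (F (y(e := 1)) - F y) + (1 - p) * (F (y(e := 0)) - F y) > 0"
        using False p by (cases "p = 0") (auto intro!: add_pos_nonneg mult_pos_pos mult_nonneg_nonneg)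
      then show False using Fy by (simp add: algebra_simps)
    qed
    then show ?thesis using that by blast
  qed
  have "F (y(e := q)) \<le> F x" using q(2) y(3) by linarith
  moreover have "\<forall>e'\<in>insert e E. (y(e := q)) e' = 0 \<or> (y(e := q)) e' = 1" using y(1) q(1) by auto
  moreover have "\<forall>e'. e' \<notin> insert e E \<longrightarrow> (y(e := q)) e' = x e'" using y(2) by auto
  ultimately show ?case by blast
qed

section \<open>A ranking and numerical estimates\<close>

text \<open>Ranks start at 0 and follow decreasing values of \<open>f\<close>: the
  \<open>rk v + 1\<close> elements up to \<open>v\<close> all have value at least
  \<open>f v\<close>. Ranking by \<open>- f\<close> makes the induction insert an element of
  smallest \<open>f\<close> last, with rank \<open>card S\<close>.\<close>

lemma exists_rank:
  fixes f :: "'a \<Rightarrow> real"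
  assumes "finite A" "\<And>v. v \<in> A \<Longrightarrow> 0 \<le> f v"
  shows "\<exists>rk. inj_on rk A \<and> (\<forall>v\<in>A. rk v < card A \<and> real (rk v + 1) * f v \<le> sum f A)"
  using assms
proof (induction A rule: finite_ranking_induct[where f = "\<lambda>v. - f v"])
  case empty
  then show ?case by simp
next
  case (insert x S)
  show ?case
  proof (cases "x \<in> S")
    case True
    then show ?thesis using insert by (simp add: insert_absorb)
  next
    case False
    obtain rk where rk: "inj_on rk S" "\<And>v. v \<in> S \<Longrightarrow> rk v < card S"
      "\<And>v. v \<in> S \<Longrightarrow> real (rk v + 1) * f v \<le> sum f S"
      using insert.IH insert.prems by (auto simp: Ball_def)
    define rk' where "rk' = rk(x := card S)"
    have eq: "rk' x = card S" "\<And>v. v \<in> S \<Longrightarrow> rk' v = rk v" using False by (auto simp: rk'_def)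
    have inj: "inj_on rk' (insert x S)"
    proof -
      have "inj_on rk' S" using rk(1) eq(2) by (simp cong: inj_on_cong)
      moreover have "rk' x \<notin> rk' ` S" using eq rk(2) by fastforce
      ultimately show ?thesis by (simp add: inj_on_insert False)
    qed
    have "(\<Sum>v\<in>S. f x) \<le> sum f S"
      using insert.hyps(2) by (intro sum_mono) auto
    then have "real (card S + 1) * f x \<le> sum f (insert x S)"
      using insert.hyps False by (simp add: algebra_simps)
    moreover have "sum f S \<le> sum f (insert x S)"
      using insert.hyps False insert.prems by simp
    moreover have "card (insert x S) = Suc (card S)" using insert.hyps False by simp
    ultimately have "rk' v < card (insert x S) \<and> real (rk' v + 1) * f v \<le> sum f (insert x S)"
      if "v \<in> insert x S" for v
      using rk(2,3)[of v] eq that by (cases "v = x") auto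
    then show ?thesis using inj by (intro exI[of _ rk']) blast
  qed
qed

text \<open>The sum is the logarithm of \<open>k^k / k!\<close>, so this is the bound
  \<open>k! \<ge> (k / e)^k\<close>. The induction rests on
  \<open>ln (1 + 1/n) \<le> 1/n\<close>.\<close>

lemma sum_ln_ratio_le:
  "(\<Sum>j\<in>{1..k}. ln (real k / real j)) \<le> real k"
proof (cases "k = 0")
  case False
  have *: "real n * ln (real n) - real n \<le> (\<Sum>j\<in>{1..n}. ln (real j))" for n
  proof (induction n)
    case (Suc n)
    show ?case
    proof (cases "n = 0")
      case False
      then have n: "real n > 0" by simp
      have "ln (real (Suc n)) = ln (real n) + ln (1 + 1 / real n)"
      proof -
        have "real (Suc n) = real n * (1 + 1 / real n)" using n by (simp add: field_simps)
        moreover have "0 < 1 + 1 / real n" using n by (simp add: add_pos_pos)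
        ultimately show ?thesis using n by (simp only: ln_mult_pos)
      qed
      also have "ln (1 + 1 / real n) \<le> 1 / real n" using n by (intro ln_add_one_self_le_self) simp
      finally have "real n * ln (real (Suc n)) \<le> real n * (ln (real n) + 1 / real n)"
        using n by (intro mult_left_mono) auto
      also have "\<dots> = real n * ln (real n) + 1" using n by (simp add: field_simps)
      finally have "real n * ln (real (Suc n)) \<le> real n * ln (real n) + 1" .
      then show ?thesis using Suc by (simp add: algebra_simps)
    qed simp
  qed simp
  have "(\<Sum>j\<in>{1..k}. ln (real k / real j)) = (\<Sum>j\<in>{1..k}. ln (real k) - ln (real j))"
    using False by (intro sum.cong) (auto simp: ln_div)
  also have "\<dots> = real k * ln (real k) - (\<Sum>j\<in>{1..k}. ln (real j))"
    by (simp add: sum_subtractf)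
  also have "\<dots> \<le> real k" using *[of k] by linarith
  finally show ?thesis .
qed simp

lemma square_le_power_two: "(2 * s + 1)\<^sup>2 \<le> 16 * (2 :: nat) ^ s"
proof (induction s rule: nat_less_induct)
  case (1 s)
  show ?case
  proof (cases "s < 3")
    case True
    then have "s = 0 \<or> s = 1 \<or> s = 2" by linarith
    then show ?thesis by auto
  next
    case False
    then obtain r where s: "s = Suc r" and r: "r \<ge> 2" by (cases s) auto
    have "(2 * s + 1)\<^sup>2 \<le> 2 * (2 * r + 1)\<^sup>2"
    proof -
      obtain q where "r = q + 2" using r by (metis add.commute le_Suc_ex)
      then show ?thesis by (simp add: s power2_eq_square algebra_simps)
    qed
    also have "\<dots> \<le> 2 * (16 * 2 ^ r)" using 1 s by (intro mult_le_mono2) auto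
    finally show ?thesis by (simp add: s)
  qed
qed

section \<open>A colouring of a graph with given blocks\<close>

definition degree :: "'a set set \<Rightarrow> 'a \<Rightarrow> nat" where
  "degree E v = card {e \<in> E. v \<in> e}"

definition colour_weight :: "bool \<Rightarrow> real \<Rightarrow> real" where
  "colour_weight c p = (if c then p else 1 - p)"

text \<open>\<open>A\<close> consists of the vertices of large degree, cut into blocks of at most \<open>n div 4\<close> vertices in
  the order of decreasing degrees.\<close>

locale blocked_graph =
  fixes V :: "'a set" and E :: "'a set set" and k n :: nat and A :: "'a set" and block :: "'a \<Rightarrow> nat"
  assumes finV: "finite V" and EV: "E \<subseteq> [V]\<^bsup>2\<^esup>" and k: "k \<ge> 2" and AV: "A \<subseteq> V"
    and degree_low: "v \<in> V - A \<Longrightarrow> real (degree E v) \<le> 2 ^ k * real n / 128"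
    and degree_block: "v \<in> A \<Longrightarrow> real (block v) * real (degree E v) \<le> real k * 2 ^ k * real n / 128"
    and block_less: "v \<in> A \<Longrightarrow> 2 * block v < k"
    and card_block: "card {v \<in> A. block v = j} \<le> n div 4"
    and card_A: "real (card A) \<le> real k * real n / 512"
    and n_large: "2 * real (card V) ^ k * exp (real n / 8) < 2 ^ (n div 2)"
begin

lemma finE: "finite E"
  using finite_subset[OF EV] finV by (simp add: finite_imp_finite_nsets)

lemma finA: "finite A"
  using AV finV finite_subset by blast

text \<open>Chosen so that \<open>(1 - bias v)^k\<close> is at most \<open>j / k\<close> in block
  \<open>j > 0\<close>, which cancels the degree bound of order \<open>2^k * k * n / j\<close>
  there. In block 0 degrees are not bounded, and bias 1 rules out the colour \<open>True\<close> on
  all edges from it that leave \<open>A\<close>.\<close>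

definition bias :: "'a \<Rightarrow> real" where
  "bias v = (if v \<notin> A then 0 else if block v = 0 then 1 else ln (real k / real (block v)) / real k)"

text \<open>The probability that an edge gets the colour \<open>True\<close>. For edges not inside \<open>A\<close>, one
  of the two biases in the product vanishes.\<close>

definition prob_edge :: "'a set \<Rightarrow> real" where
  "prob_edge e = (if e \<subseteq> A then (if \<exists>j. \<forall>v\<in>e. block v = j then 1 else 0) else 2 * (\<Prod>v\<in>e. (1 - bias v) / 2))"

lemma bias_bounds: "0 \<le> bias v" "bias v \<le> 1"
proof -
  have "0 \<le> ln (real k / real (block v)) \<and> ln (real k / real (block v)) \<le> real k"
    if "v \<in> A" "block v \<noteq> 0"
  proof -
    have b: "1 \<le> real (block v)" "real (block v) \<le> real k" using block_less[OF that(1)] that(2) by auto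
    then have "1 \<le> real k / real (block v)" "real k / real (block v) \<le> real k"
      by (auto simp: field_simps mult_le_cancel_left1)
    moreover have "ln (real k / real (block v)) \<le> real k / real (block v) - 1"
      using b by (intro ln_le_minus_one) (auto intro: divide_pos_pos)
    ultimately show ?thesis by auto
  qed
  then show "0 \<le> bias v" "bias v \<le> 1" using k by (auto simp: bias_def divide_le_eq_1)
qed

lemma bias_outside [simp]: "v \<notin> A \<Longrightarrow> bias v = 0"
  by (simp add: bias_def)

lemma prob_edge_outside:
  assumes "u \<noteq> v" "v \<notin> A"
  shows "prob_edge {u, v} = (1 - bias u) / 2"
  using assms by (simp add: prob_edge_def)

lemma prob_edge_outside':
  assumes "u \<noteq> v" "u \<notin> A"
  shows "prob_edge {u, v} = (1 - bias v) / 2"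
  using prob_edge_outside[of v u] assms by (simp add: insert_commute)

lemma prob_edge_inside:
  assumes "u \<in> A" "v \<in> A"
  shows "prob_edge {u, v} = of_bool (block u = block v)"
  using assms by (auto simp: prob_edge_def)

lemma prob_edge_bounds:
  assumes "u \<noteq> v"
  shows "0 \<le> prob_edge {u, v}" "prob_edge {u, v} \<le> 1"
proof -
  consider "u \<in> A" "v \<in> A" | "v \<notin> A" | "u \<notin> A" by blast
  then have "0 \<le> prob_edge {u, v} \<and> prob_edge {u, v} \<le> 1"
  proof cases
    case 1 then show ?thesis by (simp add: prob_edge_inside)
  next
    case 2 then show ?thesis using bias_bounds[of u] assms by (simp add: prob_edge_outside)
  next
    case 3 then show ?thesis using bias_bounds[of v] assms by (simp add: prob_edge_outside')
  qed
  then show "0 \<le> prob_edge {u, v}" "prob_edge {u, v} \<le> 1" by auto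
qed

lemma edgeE:
  assumes "e \<in> E"
  obtains u v where "e = {u, v}" "u \<noteq> v"
  using assms EV by (meson nsets2_E subsetD)

text \<open>The colours inside \<open>A\<close> being fixed by the blocks, only such sets can be
  spines of a monochromatic book in colour \<open>c\<close>.\<close>

definition spine :: "'a set \<Rightarrow> bool \<Rightarrow> bool" where
  "spine K c \<longleftrightarrow> K \<subseteq> V \<and> card K = k \<and>
    (if c then \<exists>j. \<forall>u\<in>K \<inter> A. block u = j else inj_on block (K \<inter> A))"

text \<open>The possible pages of a monochromatic book with spine \<open>K\<close>, apart from those in one block.\<close>

definition pages :: "'a set \<Rightarrow> bool \<Rightarrow> 'a set" where
  "pages K c = {v \<in> V - K. (\<forall>u\<in>K. {u, v} \<in> E) \<and>
    (if c then K \<inter> A = {} \<or> v \<notin> A else \<not> (v \<in> A \<and> block v = 0))}"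

lemma finite_pages: "finite (pages K c)"
  using finV by (simp add: pages_def)

lemma card_pages_le_degree:
  assumes "u \<in> K"
  shows "card (pages K c) \<le> degree E u"
proof -
  have "(\<lambda>v. {u, v}) ` pages K c \<subseteq> {e \<in> E. u \<in> e}" using assms by (auto simp: pages_def)
  moreover have "inj_on (\<lambda>v. {u, v}) (pages K c)" by (auto simp: inj_on_def doubleton_eq_iff)
  ultimately show ?thesis unfolding degree_def using finE
    by (metis (no_types, lifting) card_image card_mono finite_subset mem_Collect_eq subsetI)
qed

lemma spine_finite: "spine K c \<Longrightarrow> finite K"
  using finV finite_subset unfolding spine_def by blast

lemma sum_pages_le:
  assumes w: "w \<in> K" "w \<in> V - A" and b: "\<And>v. v \<in> S \<Longrightarrow> f v \<le> b / 2 ^ k" and b0: "0 \<le> b"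
    and S: "S \<subseteq> pages K c"
  shows "(\<Sum>v\<in>S. f v) \<le> b * real n / 128"
proof -
  have "(\<Sum>v\<in>S. f v) \<le> real (card S) * (b / 2 ^ k)"
    by (rule sum_bounded_above) (rule b)
  also have "\<dots> \<le> 2 ^ k * real n / 128 * (b / 2 ^ k)"
  proof (rule mult_right_mono)
    have "card S \<le> degree E w"
      using card_mono[OF finite_pages S] card_pages_le_degree[OF w(1)] by (meson order_trans)
    then show "real (card S) \<le> 2 ^ k * real n / 128" using degree_low[OF w(2)] by linarith
  qed (use b0 in simp)
  also have "\<dots> = b * real n / 128" by simp
  finally show ?thesis .
qed

text \<open>If the spine leaves \<open>A\<close>, every edge to a page has an end outside
  \<open>A\<close> and gets \<open>True\<close> with probability at most 1/2, while a spine vertex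
  of low degree limits the pages. Otherwise the spine lies in a single block \<open>j\<close>, and
  the probability, at most \<open>j / (k * 2^k)\<close>, cancels the degree bound of that
  block.\<close>

lemma expected_pages_True:
  assumes K: "spine K True"
  shows "(\<Sum>v\<in>pages K True. \<Prod>u\<in>K. prob_edge {u, v}) \<le> real n / 8"
proof (cases "K \<subseteq> A")
  case False
  then obtain w where w: "w \<in> K" "w \<in> V - A" using K by (auto simp: spine_def)
  have "(\<Prod>u\<in>K. prob_edge {u, v}) \<le> 1 / 2 ^ k" if v: "v \<in> pages K True" for v
  proof -
    have "(\<Prod>u\<in>K. prob_edge {u, v}) \<le> (\<Prod>u\<in>K. 1 / 2)"
    proof (rule prod_mono)
      fix u assume u: "u \<in> K"
      then have "u \<noteq> v" "u \<notin> A \<or> v \<notin> A" using v by (auto simp: pages_def)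
      then show "0 \<le> prob_edge {u, v} \<and> prob_edge {u, v} \<le> 1 / 2"
        using prob_edge_bounds[of u v] bias_bounds[of u] bias_bounds[of v]
        by (auto simp: prob_edge_outside prob_edge_outside')
    qed
    then show ?thesis using K by (simp add: spine_def power_one_over)
  qed
  then have "(\<Sum>v\<in>pages K True. \<Prod>u\<in>K. prob_edge {u, v}) \<le> 1 * real n / 128"
    by (intro sum_pages_le[OF w]) auto
  then show ?thesis by simp
next
  case True
  obtain j where j: "\<And>u. u \<in> K \<Longrightarrow> block u = j" using K True by (auto simp: spine_def)
  have cK: "card K = k" using K by (simp add: spine_def)
  then obtain w where w: "w \<in> K" using k by fastforce
  define a where "a = bias w"
  have bias: "bias u = a" if "u \<in> K" for u
    using that True w j unfolding a_def bias_def by auto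
  have "(\<Prod>u\<in>K. prob_edge {u, v}) = ((1 - a) / 2) ^ k" if v: "v \<in> pages K True" for v
  proof -
    have "v \<notin> A" "\<And>u. u \<in> K \<Longrightarrow> u \<noteq> v" using v True w by (auto simp: pages_def)
    then have "(\<Prod>u\<in>K. prob_edge {u, v}) = (\<Prod>u\<in>K. (1 - a) / 2)"
      by (intro prod.cong refl) (simp add: prob_edge_outside bias)
    then show ?thesis using cK by simp
  qed
  then have eq: "(\<Sum>v\<in>pages K True. \<Prod>u\<in>K. prob_edge {u, v}) = real (card (pages K True)) * ((1 - a) / 2) ^ k"
    by simp
  show ?thesis
  proof (cases "j = 0")
    case True
    then have "a = 1" using j[OF w] w \<open>K \<subseteq> A\<close> by (auto simp: a_def bias_def)
    then show ?thesis unfolding eq using k by (simp add: power_0_left)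
  next
    case False
    have a: "a = ln (real k / real j) / real k"
      using False j[OF w] w \<open>K \<subseteq> A\<close> by (auto simp: a_def bias_def)
    have "(1 - a) ^ k \<le> exp (- a) ^ k"
      using bias_bounds[of w] exp_ge_add_one_self[of "- a"] by (intro power_mono) (auto simp: a_def)
    also have "\<dots> = exp (- ln (real k / real j))"
      using k by (simp add: exp_of_nat_mult[symmetric] a)
    also have "\<dots> = real j / real k"
      using False k by (simp add: exp_minus)
    finally have "(1 - a) ^ k \<le> real j / real k" .
    then have "((1 - a) / 2) ^ k \<le> real j / real k / 2 ^ k"
      unfolding power_divide by (rule divide_right_mono) simp
    then have "real (card (pages K True)) * ((1 - a) / 2) ^ k
        \<le> real (degree E w) * (real j / real k / 2 ^ k)"
      using card_pages_le_degree[OF w, of True] bias_bounds[of w]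
      by (intro mult_mono) (auto simp: a_def)
    also have "\<dots> = real j * real (degree E w) / (real k * 2 ^ k)" by simp
    also have "\<dots> \<le> real k * 2 ^ k * real n / 128 / (real k * 2 ^ k)"
      using degree_block[of w] j[OF w] w \<open>K \<subseteq> A\<close> by (intro divide_right_mono) auto
    also have "\<dots> \<le> real n / 8" using k by simp
    finally show ?thesis unfolding eq .
  qed
qed

lemma card_spine_inside:
  assumes K: "spine K False"
  shows "card (K \<inter> A) \<le> (k + 1) div 2"
proof -
  have "inj_on block (K \<inter> A)" using K by (simp add: spine_def)
  moreover have "block ` (K \<inter> A) \<subseteq> {..<(k + 1) div 2}"
  proof
    fix j assume "j \<in> block ` (K \<inter> A)"
    then have "2 * j < k" using block_less by auto
    then show "j \<in> {..<(k + 1) div 2}" by auto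
  qed
  ultimately show ?thesis using card_inj_on_le[of block "K \<inter> A" "{..<(k + 1) div 2}"] by simp
qed

text \<open>Distinct blocks contribute at most 2 for block 0 and \<open>exp (ln (k / j) / k)\<close>
  for each \<open>j\<close> from 1 to \<open>k\<close>. By \<open>sum_ln_ratio_le\<close> the latter
  multiply to at most \<open>e\<close>, so the bias costs only a constant factor.\<close>

lemma prod_bias_le:
  assumes K: "spine K False"
  shows "(\<Prod>u\<in>K. 1 + bias u) \<le> 6"
proof -
  define \<beta> where "\<beta> j = (if j = 0 then 2 else exp (ln (real k / real j) / real k))" for j :: nat
  have finK: "finite K" using K by (rule spine_finite)
  have inj: "inj_on block (K \<inter> A)" using K by (simp add: spine_def)
  have \<beta>1: "1 \<le> \<beta> j" if "j \<le> k" for j using that k by (auto simp: \<beta>_def)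
  have "(\<Prod>u\<in>K. 1 + bias u) = (\<Prod>u\<in>K \<inter> A. 1 + bias u)"
    using finK by (intro prod.mono_neutral_right) auto
  also have "\<dots> \<le> (\<Prod>u\<in>K \<inter> A. \<beta> (block u))"
  proof (rule prod_mono)
    fix u assume "u \<in> K \<inter> A"
    then have "1 + bias u \<le> \<beta> (block u)" by (simp add: \<beta>_def bias_def)
    moreover have "0 \<le> 1 + bias u" using bias_bounds[of u] by linarith
    ultimately show "0 \<le> 1 + bias u \<and> 1 + bias u \<le> \<beta> (block u)" by simp
  qed
  also have "\<dots> = (\<Prod>j\<in>block ` (K \<inter> A). \<beta> j)" by (simp add: prod.reindex[OF inj])
  also have "\<dots> \<le> (\<Prod>j\<in>{0..k}. \<beta> j)"
  proof (rule prod_mono2)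
    show "block ` (K \<inter> A) \<subseteq> {0..k}" using block_less by fastforce
    show "0 \<le> \<beta> j" for j by (simp add: \<beta>_def)
  qed (use \<beta>1 in auto)
  also have "\<dots> = 2 * (\<Prod>j\<in>{1..k}. exp (ln (real k / real j) / real k))"
    by (simp add: prod.atLeast_Suc_atMost \<beta>_def)
  also have "(\<Prod>j\<in>{1..k}. exp (ln (real k / real j) / real k)) = exp ((\<Sum>j\<in>{1..k}. ln (real k / real j)) / real k)"
    by (simp add: exp_sum sum_divide_distrib)
  also have "\<dots> \<le> exp 1"
    using sum_ln_ratio_le[of k] k by simp
  also have "\<dots> \<le> (3 :: real)" by (rule exp_le)
  finally show ?thesis by simp
qed

text \<open>Pages outside \<open>A\<close> have probability at most \<open>6 / 2^k\<close> and are
  limited by a spine vertex of low degree. For pages in \<open>A\<close>, the size of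
  \<open>A\<close> and the \<open>s\<close> spine vertices outside \<open>A\<close> suffice, since
  \<open>k \<le> 2 * s + 1\<close> keeps \<open>k^2 / 2^s\<close> bounded. The total
  \<open>6/128 + 4/128\<close> is below \<open>1/8\<close>.\<close>

lemma expected_pages_False:
  assumes K: "spine K False"
  shows "(\<Sum>v\<in>pages K False. \<Prod>u\<in>K. 1 - prob_edge {u, v}) \<le> real n / 8"
proof -
  have finK: "finite K" using K by (rule spine_finite)
  have cK: "card K = k" using K by (simp add: spine_def)
  have t: "card (K \<inter> A) \<le> (k + 1) div 2" using K by (rule card_spine_inside)
  define s where "s = card (K - A)"
  have st: "s + card (K \<inter> A) = k"
    using card_Diff_subset_Int[of K A] finK cK card_mono[OF finK, of "K \<inter> A"] by (simp add: s_def)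
  have "s \<noteq> 0" using st t k by linarith
  then have "K - A \<noteq> {}" unfolding s_def by force
  then obtain w where w: "w \<in> K" "w \<in> V - A" using K by (auto simp: spine_def)
  have ks: "k \<le> 2 * s + 1" using st t by linarith
  have outside: "(\<Prod>u\<in>K. 1 - prob_edge {u, v}) \<le> 6 / 2 ^ k" if v: "v \<in> pages K False - A" for v
  proof -
    have "v \<notin> A" "\<And>u. u \<in> K \<Longrightarrow> u \<noteq> v" using v by (auto simp: pages_def)
    then have "(\<Prod>u\<in>K. 1 - prob_edge {u, v}) = (\<Prod>u\<in>K. (1 + bias u) / 2)"
      by (intro prod.cong refl) (simp add: prob_edge_outside field_simps)
    also have "\<dots> = (\<Prod>u\<in>K. 1 + bias u) / 2 ^ k" using cK by (simp add: prod_dividef)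
    also have "\<dots> \<le> 6 / 2 ^ k" using prod_bias_le[OF K] by (intro divide_right_mono) auto
    finally show ?thesis .
  qed
  \<comment> \<open>Factors from spine vertices in \<open>A\<close> are bounded by 1. The bias of
    \<open>v\<close> costs at most \<open>(1 + a)^k \<le> exp (a * k) = k / block v\<close>; block
    0, where the bias is 1 instead, is excluded from the pages.\<close>
  have inside: "(\<Prod>u\<in>K. 1 - prob_edge {u, v}) \<le> real k / 2 ^ s" if v: "v \<in> pages K False \<inter> A" for v
  proof -
    define a where "a = bias v"
    have uv: "u \<noteq> v" if "u \<in> K" for u using that v by (auto simp: pages_def)
    have b: "block v \<noteq> 0" using v by (auto simp: pages_def)
    then have a: "a = ln (real k / real (block v)) / real k" using v by (auto simp: a_def bias_def)
    have a01: "0 \<le> a" "a \<le> 1" using bias_bounds by (auto simp: a_def)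
    have "(\<Prod>u\<in>K. 1 - prob_edge {u, v}) = (\<Prod>u\<in>K - A. 1 - prob_edge {u, v}) * (\<Prod>u\<in>K \<inter> A. 1 - prob_edge {u, v})"
      using finK by (subst prod.union_disjoint[symmetric]) (auto intro: prod.cong)
    also have "\<dots> \<le> (\<Prod>u\<in>K - A. 1 - prob_edge {u, v}) * 1"
      using prob_edge_bounds[OF uv] by (intro mult_left_mono prod_le_1 prod_nonneg) auto
    also have "(\<Prod>u\<in>K - A. 1 - prob_edge {u, v}) = (\<Prod>u\<in>K - A. (1 + a) / 2)"
      using uv by (intro prod.cong refl) (simp add: prob_edge_outside' a_def field_simps)
    also have "\<dots> * 1 = (1 + a) ^ s / 2 ^ s" by (simp add: s_def power_divide)
    also have "\<dots> \<le> (1 + a) ^ k / 2 ^ s"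
      using a01 st by (intro divide_right_mono power_increasing) auto
    also have "\<dots> \<le> exp a ^ k / 2 ^ s"
      using a01 exp_ge_add_one_self[of a] by (intro divide_right_mono power_mono) auto
    also have "exp a ^ k = real k / real (block v)"
      using b k by (simp add: exp_of_nat_mult[symmetric] a)
    also have "real k / real (block v) / 2 ^ s \<le> real k / 2 ^ s"
      using b by (intro divide_right_mono) (auto simp: field_simps mult_le_cancel_left1)
    finally show ?thesis .
  qed
  have "(\<Sum>v\<in>pages K False \<inter> A. \<Prod>u\<in>K. 1 - prob_edge {u, v}) \<le> real (card (pages K False \<inter> A)) * (real k / 2 ^ s)"
    by (rule sum_bounded_above) (rule inside)
  also have "\<dots> \<le> (real k * real n / 512) * (real k / 2 ^ s)"
  proof (rule mult_right_mono)
    have "card (pages K False \<inter> A) \<le> card A" by (intro card_mono finA) auto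
    then show "real (card (pages K False \<inter> A)) \<le> real k * real n / 512" using card_A by linarith
  qed simp
  also have "\<dots> = real (k\<^sup>2) / 2 ^ s * (real n / 512)" by (simp add: power2_eq_square mult_ac)
  also have "\<dots> \<le> 16 * (real n / 512)"
  proof (rule mult_right_mono)
    have "k\<^sup>2 \<le> 16 * 2 ^ s" using square_le_power_two[of s] power_mono[OF ks, of 2] by linarith
    then have "real (k\<^sup>2) \<le> real (16 * 2 ^ s)" by (rule of_nat_mono)
    then show "real (k\<^sup>2) / 2 ^ s \<le> 16" by (simp add: field_simps)
  qed simp
  finally have in_le: "(\<Sum>v\<in>pages K False \<inter> A. \<Prod>u\<in>K. 1 - prob_edge {u, v}) \<le> 4 * real n / 128" by simp
  have out_le: "(\<Sum>v\<in>pages K False - A. \<Prod>u\<in>K. 1 - prob_edge {u, v}) \<le> 6 * real n / 128"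
    by (rule sum_pages_le[OF w outside]) auto
  have "(\<Sum>v\<in>pages K False. \<Prod>u\<in>K. 1 - prob_edge {u, v})
      = (\<Sum>v\<in>pages K False \<inter> A. \<Prod>u\<in>K. 1 - prob_edge {u, v}) + (\<Sum>v\<in>pages K False - A. \<Prod>u\<in>K. 1 - prob_edge {u, v})"
    by (rule sum.Int_Diff[OF finite_pages])
  then show ?thesis using in_le out_le by simp
qed

lemma expected_pages:
  assumes "spine K c"
  shows "(\<Sum>v\<in>pages K c. \<Prod>u\<in>K. colour_weight c (prob_edge {u, v})) \<le> real n / 8"
  using assms expected_pages_True expected_pages_False by (cases c) (auto simp: colour_weight_def)

text \<open>An exponential moment: at 0/1 values it is 2 to the number of pages joined to
  \<open>K\<close> in colour \<open>c\<close>, and at probabilities the expected value of that, as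
  edges to different pages are distinct.\<close>

definition potential_term :: "'a set \<Rightarrow> bool \<Rightarrow> ('a set \<Rightarrow> real) \<Rightarrow> real" where
  "potential_term K c x = (\<Prod>v\<in>pages K c. 1 + (\<Prod>u\<in>K. colour_weight c (x {u, v})))"

definition potential :: "('a set \<Rightarrow> real) \<Rightarrow> real" where
  "potential x = (\<Sum>(K, c)\<in>{(K, c). spine K c}. potential_term K c x)"

lemma finite_spines: "finite {(K, c). spine K c}"
  by (rule finite_subset[of _ "Pow V \<times> UNIV"]) (auto simp: spine_def finV)

lemma card_spines: "real (card {(K, c). spine K c}) \<le> 2 * real (card V) ^ k"
proof -
  have "{(K, c). spine K c} \<subseteq> {K. K \<subseteq> V \<and> card K = k} \<times> UNIV" by (auto simp: spine_def)
  moreover have "finite {K. K \<subseteq> V \<and> card K = k}" using finV by auto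
  ultimately have "card {(K, c). spine K c} \<le> card ({K. K \<subseteq> V \<and> card K = k} \<times> (UNIV :: bool set))"
    by (intro card_mono) auto
  also have "\<dots> = (card V choose k) * 2" using n_subsets[OF finV, of k] by (simp add: card_cartesian_product)
  also have "\<dots> \<le> 2 * card V ^ k"
  proof -
    have "(card V choose k) * 1 \<le> (card V choose k) * fact k" by (intro mult_le_mono2) (simp add: Suc_le_eq)
    then show ?thesis using binomial_fact_pow[of "card V" k] by linarith
  qed
  finally have "real (card {(K, c). spine K c}) \<le> real (2 * card V ^ k)" by (rule of_nat_mono)
  then show ?thesis by simp
qed

lemma potential_term_nonneg:
  assumes K: "spine K c" and x: "\<And>e. e \<in> E \<Longrightarrow> 0 \<le> x e \<and> x e \<le> 1"
  shows "0 \<le> potential_term K c x"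
  unfolding potential_term_def
  by (intro prod_nonneg add_nonneg_nonneg ballI) (use x in \<open>auto simp: pages_def colour_weight_def\<close>)

text \<open>By \<open>1 + t \<le> exp t\<close>, each term is at most the exponential of the
  expected number of pages.\<close>

lemma potential_prob_edge_le: "potential prob_edge \<le> 2 * real (card V) ^ k * exp (real n / 8)"
proof -
  have "potential_term K c prob_edge \<le> exp (real n / 8)" if K: "spine K c" for K c
  proof -
    have "potential_term K c prob_edge
        \<le> (\<Prod>v\<in>pages K c. exp (\<Prod>u\<in>K. colour_weight c (prob_edge {u, v})))"
      unfolding potential_term_def
    proof (rule prod_mono, intro conjI)
      fix v assume v: "v \<in> pages K c"
      have "0 \<le> (\<Prod>u\<in>K. colour_weight c (prob_edge {u, v}))"
      proof (rule prod_nonneg)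
        fix u assume "u \<in> K"
        then have "u \<noteq> v" using v by (auto simp: pages_def)
        then show "0 \<le> colour_weight c (prob_edge {u, v})"
          using prob_edge_bounds by (simp add: colour_weight_def)
      qed
      then show "0 \<le> 1 + (\<Prod>u\<in>K. colour_weight c (prob_edge {u, v}))" by simp
    qed simp
    also have "\<dots> = exp (\<Sum>v\<in>pages K c. \<Prod>u\<in>K. colour_weight c (prob_edge {u, v}))"
      by (simp add: exp_sum finite_pages)
    also have "\<dots> \<le> exp (real n / 8)" using expected_pages[OF K] by simp
    finally show ?thesis .
  qed
  then have "potential prob_edge \<le> real (card {(K, c). spine K c}) * exp (real n / 8)"
    unfolding potential_def by (intro sum_bounded_above) auto
  also have "\<dots> \<le> 2 * real (card V) ^ k * exp (real n / 8)"
    using card_spines by (intro mult_right_mono) auto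
  finally show ?thesis .
qed

lemma affine_at_colour_weight: "affine_at e (\<lambda>x. colour_weight c (x e'))"
  by (rule affine_atI) (auto simp: colour_weight_def algebra_simps)

lemma indep_of_colour_weight: "e \<noteq> e' \<Longrightarrow> indep_of e (\<lambda>x. colour_weight c (x e'))"
  by (auto simp: indep_of_def)

text \<open>Pages lie outside \<open>K\<close>, so \<open>e\<close> is \<open>{u, v}\<close> for at
  most one spine vertex \<open>u\<close> and one page \<open>v\<close>. Both the inner and the outer
  product therefore have at most one factor depending on \<open>e\<close>.\<close>

lemma affine_at_potential_term:
  assumes K: "spine K c"
  shows "affine_at e (potential_term K c)"
proof -
  have finK: "finite K" using K by (rule spine_finite)
  have ind: "indep_of e (\<lambda>x. 1 + (\<Prod>u\<in>K. colour_weight c (x {u, v})))" if "\<And>u. u \<in> K \<Longrightarrow> e \<noteq> {u, v}" for v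
  proof -
    have "indep_of e (\<lambda>x. \<Prod>u\<in>K. colour_weight c (x {u, v}))"
      by (intro indep_of_prod indep_of_colour_weight that)
    then show ?thesis by (simp add: indep_of_def)
  qed
  have "affine_at e (\<lambda>x. \<Prod>v\<in>pages K c. 1 + (\<Prod>u\<in>K. colour_weight c (x {u, v})))"
  proof (rule affine_at_prod[OF finite_pages])
    fix v assume v: "v \<in> pages K c"
    have aff: "affine_at e (\<lambda>x. \<Prod>u\<in>K. colour_weight c (x {u, v}))"
    proof (rule affine_at_prod[OF finK affine_at_colour_weight])
      fix u u' assume "u \<in> K" "u' \<in> K" "u \<noteq> u'"
      then have "e \<noteq> {u, v} \<or> e \<noteq> {u', v}" by (auto simp: doubleton_eq_iff)
      then show "indep_of e (\<lambda>x. colour_weight c (x {u, v})) \<or> indep_of e (\<lambda>x. colour_weight c (x {u', v}))"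
        by (rule disj_forward) (erule indep_of_colour_weight)+
    qed
    show "affine_at e (\<lambda>x. 1 + (\<Prod>u\<in>K. colour_weight c (x {u, v})))"
      using aff by (rule affine_at_one_plus)
    fix v' assume v': "v' \<in> pages K c" "v \<noteq> v'"
    show "indep_of e (\<lambda>x. 1 + (\<Prod>u\<in>K. colour_weight c (x {u, v}))) \<or>
        indep_of e (\<lambda>x. 1 + (\<Prod>u\<in>K. colour_weight c (x {u, v'})))"
    proof (cases "\<exists>u\<in>K. e = {u, v}")
      case True
      then have "e \<noteq> {u, v'}" if "u \<in> K" for u
        using that v v' by (auto simp: pages_def doubleton_eq_iff)
      then show ?thesis by (intro disjI2 ind)
    next
      case False
      then show ?thesis by (intro disjI1 ind) blast
    qed
  qed
  then show ?thesis unfolding potential_term_def[abs_def] .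
qed

lemma affine_at_potential: "affine_at e potential"
proof -
  have "affine_at e (\<lambda>x. \<Sum>i\<in>{(K, c). spine K c}. (case i of (K, c) \<Rightarrow> potential_term K c x))"
    by (rule affine_at_sum) (auto intro: affine_at_potential_term)
  then show ?thesis unfolding potential_def[abs_def] .
qed

text \<open>Rounding \<open>prob_edge\<close> does not increase the potential, and a spine with at
  least \<open>n div 2\<close> pages in its colour would alone contribute \<open>2^(n div 2)\<close>
  or more.\<close>

lemma exists_colouring:
  "\<exists>\<chi> :: 'a set \<Rightarrow> bool.
     (\<forall>u\<in>A. \<forall>v\<in>A. \<chi> {u, v} = (block u = block v)) \<and>
     (\<forall>K c. spine K c \<longrightarrow> card {v \<in> pages K c. \<forall>u\<in>K. \<chi> {u, v} = c} < n div 2)"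
proof -
  \<comment> \<open>Edges inside \<open>A\<close> already have the values 0 and 1; leaving them out
    preserves the colours prescribed by the blocks.\<close>
  define E' where "E' = {e \<in> E. \<not> e \<subseteq> A}"
  have prob01: "0 \<le> prob_edge e \<and> prob_edge e \<le> 1" if "e \<in> E" for e
    using edgeE[OF that] prob_edge_bounds by metis
  have "finite E'" using finE by (simp add: E'_def)
  then obtain y where y: "\<forall>e\<in>E'. y e = 0 \<or> y e = 1" "\<forall>e. e \<notin> E' \<longrightarrow> y e = prob_edge e"
    and le: "potential y \<le> potential prob_edge"
    using affine_rounding[of E' potential prob_edge] affine_at_potential prob01 by (auto simp: E'_def)
  have y01: "y e = 0 \<or> y e = 1" if "e \<in> E" for e
  proof (cases "e \<subseteq> A")
    case True
    then have "y e = prob_edge e" using y(2) by (auto simp: E'_def)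
    then show ?thesis using True by (simp add: prob_edge_def)
  next
    case False
    then show ?thesis using y(1) that by (auto simp: E'_def)
  qed
  define \<chi> where "\<chi> e = (y e = 1)" for e
  have "\<chi> {u, v} = (block u = block v)" if "u \<in> A" "v \<in> A" for u v
    using y(2)[rule_format, of "{u, v}"] that by (auto simp: \<chi>_def E'_def prob_edge_inside)
  moreover have "card {v \<in> pages K c. \<forall>u\<in>K. \<chi> {u, v} = c} < n div 2" if K: "spine K c" for K c
  proof -
    define X where "X = {v \<in> pages K c. \<forall>u\<in>K. \<chi> {u, v} = c}"
    have w: "colour_weight c (y {u, v}) = of_bool (\<chi> {u, v} = c)" if "v \<in> pages K c" "u \<in> K" for u v
      using y01[of "{u, v}"] that by (auto simp: pages_def \<chi>_def colour_weight_def)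
    have finK: "finite K" using K by (rule spine_finite)
    have "(2 :: real) ^ card X = (\<Prod>v\<in>X. 2)" by simp
    also have "\<dots> \<le> (\<Prod>v\<in>X. 1 + (\<Prod>u\<in>K. colour_weight c (y {u, v})))"
      by (intro prod_mono) (auto simp: X_def w)
    also have "\<dots> \<le> potential_term K c y"
      unfolding potential_term_def
      by (rule prod_mono2[OF finite_pages]) (auto simp: X_def w intro!: prod_nonneg add_nonneg_nonneg)
    also have "\<dots> \<le> potential y"
    proof -
      have "(case (K, c) of (K, c) \<Rightarrow> potential_term K c y) \<le> potential y"
        unfolding potential_def
      proof (rule member_le_sum[OF _ _ finite_spines])
        fix i assume "i \<in> {(K, c). spine K c} - {(K, c)}"
        then obtain L d where "i = (L, d)" "spine L d" by auto
        then show "0 \<le> (case i of (K, c) \<Rightarrow> potential_term K c y)"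
          using potential_term_nonneg[of L d y] y01 by force
      qed (use K in simp)
      then show ?thesis by simp
    qed
    also have "\<dots> < 2 ^ (n div 2)" using le potential_prob_edge_le n_large by linarith
    finally show ?thesis unfolding X_def by simp
  qed
  ultimately show ?thesis by blast
qed

text \<open>In a monochromatic book fewer than \<open>n div 2\<close> vertices of \<open>P\<close>
  are counted by \<open>pages\<close>, and the others lie in a single block of at most
  \<open>n div 4\<close> vertices.\<close>

lemma exists_colouring_without_book:
  obtains \<chi> :: "'a set \<Rightarrow> bool" where
    "\<And>K P c. K \<inter> P = {} \<Longrightarrow> card K = k \<Longrightarrow> K \<subseteq> V \<Longrightarrow> P \<subseteq> V \<Longrightarrow>
      (\<And>u v. u \<in> K \<Longrightarrow> v \<in> K \<union> P \<Longrightarrow> u \<noteq> v \<Longrightarrow> {u, v} \<in> E \<and> \<chi> {u, v} = c) \<Longrightarrow> card P < n"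
proof -
  obtain \<chi> :: "'a set \<Rightarrow> bool" where \<chi>A: "\<And>u v. u \<in> A \<Longrightarrow> v \<in> A \<Longrightarrow> \<chi> {u, v} = (block u = block v)"
    and few: "\<And>K c. spine K c \<Longrightarrow> card {v \<in> pages K c. \<forall>u\<in>K. \<chi> {u, v} = c} < n div 2"
    using exists_colouring by blast
  have "card P < n"
    if KP: "K \<inter> P = {}" "card K = k" "K \<subseteq> V" "P \<subseteq> V"
      and mono: "\<And>u v. u \<in> K \<Longrightarrow> v \<in> K \<union> P \<Longrightarrow> u \<noteq> v \<Longrightarrow> {u, v} \<in> E \<and> \<chi> {u, v} = c"
    for K P c
  proof -
    define X where "X = {v \<in> pages K c. \<forall>u\<in>K. \<chi> {u, v} = c}"
    have blocks: "(block u = block v) = c" if "u \<in> K \<inter> A" "v \<in> (K \<union> P) \<inter> A" "u \<noteq> v" for u v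
      using mono[of u v] \<chi>A[of u v] that by auto
    have "spine K c"
    proof (cases c)
      case True
      have "\<exists>j. \<forall>u\<in>K \<inter> A. block u = j"
      proof (cases "K \<inter> A = {}")
        case False
        then obtain w where "w \<in> K \<inter> A" by blast
        then show ?thesis using blocks[of w] True by (intro exI[of _ "block w"]) (metis IntE IntI UnI1)
      qed auto
      then show ?thesis using KP True by (simp add: spine_def)
    next
      case False
      then have "inj_on block (K \<inter> A)" using blocks by (fastforce simp: inj_on_def)
      then show ?thesis using KP False by (simp add: spine_def)
    qed
    then have X: "card X < n div 2" unfolding X_def by (rule few)
    have page: "v \<in> V - K" "\<And>u. u \<in> K \<Longrightarrow> {u, v} \<in> E \<and> \<chi> {u, v} = c" if "v \<in> P" for v
      using that KP mono[of _ v] by blast+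
    \<comment> \<open>For \<open>True\<close>, a vertex of \<open>P\<close> in \<open>A\<close> is
      joined in this colour to a spine vertex \<open>w\<close> in \<open>A\<close>, if there is one,
      and hence lies in its block. For \<open>False\<close>, only block 0 was left out of
      \<open>pages\<close>.\<close>
    obtain j where j: "P - X \<subseteq> {v \<in> A. block v = j}"
    proof (cases c)
      case True
      show ?thesis
      proof (cases "K \<inter> A = {}")
        case empty: True
        have "P \<subseteq> X" using page True empty unfolding X_def pages_def by auto
        then show ?thesis using that by blast
      next
        case False
        then obtain w where w: "w \<in> K" "w \<in> A" by blast
        have "v \<in> A \<and> block v = block w" if v: "v \<in> P - X" for v
        proof -
          have "v \<in> A" using v page[of v] True unfolding X_def pages_def by auto
          moreover have "block w = block v" using blocks[of w v] w v calculation KP(1) True by blast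
          ultimately show ?thesis by simp
        qed
        then show ?thesis using that[of "block w"] by blast
      qed
    next
      case False
      have "P - X \<subseteq> {v \<in> A. block v = 0}" using page False unfolding X_def pages_def by auto
      then show ?thesis using that by blast
    qed
    have "card (P - X) \<le> n div 4"
      using card_mono[OF _ j] finA card_block[of j] by fastforce
    moreover have "card P \<le> card X + card (P - X)"
    proof -
      have "finite X" using finite_pages by (simp add: X_def)
      moreover have "finite P" using KP finV finite_subset by blast
      ultimately have "card P \<le> card (X \<union> (P - X))" by (intro card_mono) auto
      also have "\<dots> \<le> card X + card (P - X)" by (rule card_Un_le)
      finally show ?thesis .
    qed
    ultimately show ?thesis using X by linarith
  qed
  then show thesis by (rule that)
qed

end

section \<open>Blocks in a graph with few edges\<close>

lemma sum_degree:
  assumes "finite V" "E \<subseteq> [V]\<^bsup>2\<^esup>"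
  shows "(\<Sum>v\<in>V. degree E v) = 2 * card E"
proof -
  have finE: "finite E"
    using finite_subset[OF assms(2)] assms(1) by (simp add: finite_imp_finite_nsets)
  have "(\<Sum>v\<in>V. degree E v) = (\<Sum>v\<in>V. \<Sum>e\<in>E. of_bool (v \<in> e))"
    using finE by (simp add: degree_def Int_def)
  also have "\<dots> = (\<Sum>e\<in>E. \<Sum>v\<in>V. of_bool (v \<in> e))" by (rule sum.swap)
  also have "\<dots> = (\<Sum>e\<in>E. 2)"
  proof (rule sum.cong[OF refl])
    fix e assume "e \<in> E"
    then have e: "e \<subseteq> V" "card e = 2" using assms(2) by (auto simp: nsets_def)
    then have "V \<inter> {v. v \<in> e} = e" by blast
    then show "(\<Sum>v\<in>V. of_bool (v \<in> e)) = (2 :: nat)" using assms(1) e by simp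
  qed
  finally show ?thesis by simp
qed

text \<open>For fixed \<open>k\<close> the number of spines is polynomial in \<open>n\<close>, while
  \<open>exp (n / 8)\<close> is exponentially smaller than \<open>2^(n div 2)\<close>.\<close>

lemma eventually_power_exp_less:
  "\<exists>n0. \<forall>n\<ge>n0. 2 * (real k * 2 ^ k * real n ^ 2) ^ k * exp (real n / 8) < 2 ^ (n div 2)"
proof -
  \<comment> \<open>The factor \<open>24^(2 * k)\<close> comes from writing
    \<open>n = 24 * x\<close>; the polynomial is then below \<open>exp x = exp (n / 24)\<close>, and
    \<open>1/24 + 1/8 = 1/6\<close>.\<close>
  define a where "a = 2 * (real k * 2 ^ k) ^ k * 24 ^ (2 * k)"
  have "((\<lambda>x :: real. a * (x ^ (2 * k) / exp x)) \<longlongrightarrow> a * 0) at_top"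
    by (intro tendsto_mult tendsto_const tendsto_power_div_exp_0)
  then have "\<forall>\<^sub>F x in at_top. a * (x ^ (2 * k) / exp x) < 1"
    by (rule order_tendstoD) simp
  then obtain x0 where x0: "\<And>x. x \<ge> x0 \<Longrightarrow> a * (x ^ (2 * k) / exp x) < 1"
    by (auto simp: eventually_at_top_linorder)
  have "2 * (real k * 2 ^ k * real n ^ 2) ^ k * exp (real n / 8) < 2 ^ (n div 2)"
    if n: "n \<ge> nat \<lceil>24 * x0\<rceil> + 3" for n
  proof -
    define x where "x = real n / 24"
    have "x \<ge> x0" using n by (simp add: x_def) linarith
    then have lt: "a * x ^ (2 * k) < exp x" using x0[of x] by (simp add: field_simps)
    have "2 * (real k * 2 ^ k * real n ^ 2) ^ k = a * x ^ (2 * k)"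
      by (simp add: a_def x_def power_mult_distrib power_divide power_mult)
    then have "2 * (real k * 2 ^ k * real n ^ 2) ^ k * exp (real n / 8) < exp x * exp (real n / 8)"
      using lt by simp
    also have "\<dots> = exp (real n / 6)" by (simp add: exp_add[symmetric] x_def)
    also have "\<dots> \<le> exp (real (n div 2) * ln 2)"
    proof -
      have "real n / 3 \<le> real (n div 2)" using n by linarith
      moreover have "1 / 2 \<le> ln (2 :: real)" using exp_half_le2 by (subst ln_ge_iff) auto
      ultimately have "real n / 3 * (1 / 2) \<le> real (n div 2) * ln 2" by (intro mult_mono) auto
      then show ?thesis by simp
    qed
    also have "\<dots> = 2 ^ (n div 2)" by (simp add: exp_of_nat_mult)
    finally show ?thesis .
  qed
  then show ?thesis by blast
qed

text \<open>The degrees sum to at most \<open>k * 2^k * n^2 / 2^16\<close>, so at most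
  \<open>k * n / 512\<close> vertices have degree \<open>2^k * n / 128\<close> or more; these form
  \<open>A\<close>. A vertex of rank \<open>r\<close> has degree at most this sum divided by
  \<open>r + 1\<close>, and block \<open>j\<close> consists of ranks at least
  \<open>j * n / 5\<close>, which yields the degree bound in each block.\<close>

lemma exists_blocked_graph:
  assumes k: "k \<ge> 2" and n: "n \<ge> 15" and V: "finite V" "E \<subseteq> [V]\<^bsup>2\<^esup>" "V = \<Union>E"
    and few: "real (card E) \<le> real k * 2 ^ k * real n ^ 2 / 2 ^ 17"
    and large: "2 * (real k * 2 ^ k * real n ^ 2) ^ k * exp (real n / 8) < 2 ^ (n div 2)"
  shows "\<exists>A block. blocked_graph V E k n A block"
proof -
  define h where "h = n div 4"
  \<comment> \<open>Rounding down \<open>n / 4\<close> loses at most 3/4, which is at most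
    \<open>n / 20\<close> for \<open>n \<ge> 15\<close>.\<close>
  have h: "real n / 5 \<le> real h" using n unfolding h_def by linarith
  have h0: "h > 0" using n by (simp add: h_def)
  define A where "A = {v \<in> V. 2 ^ k * real n / 128 \<le> real (degree E v)}"
  have finA: "finite A" using V(1) by (simp add: A_def)
  have "(\<Sum>v\<in>A. degree E v) \<le> 2 * card E"
    unfolding sum_degree[OF V(1,2), symmetric] using V(1) by (intro sum_mono2) (auto simp: A_def)
  then have "real (\<Sum>v\<in>A. degree E v) \<le> real (2 * card E)" by (rule of_nat_mono)
  then have degA: "(\<Sum>v\<in>A. real (degree E v)) \<le> real k * 2 ^ k * real n ^ 2 / 2 ^ 16"
    using few by simp
  have cA: "real (card A) \<le> real k * real n / 512"
  proof -
    have "real (card A) * (2 ^ k * real n / 128) \<le> (\<Sum>v\<in>A. real (degree E v))"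
      by (rule sum_bounded_below) (simp add: A_def)
    then have "real (card A) * (2 ^ k * real n / 128) \<le> real k * 2 ^ k * real n ^ 2 / 2 ^ 16"
      using degA by linarith
    also have "\<dots> = real k * real n / 512 * (2 ^ k * real n / 128)" by (simp add: power2_eq_square)
    finally show ?thesis using n by (simp add: mult_le_cancel_right)
  qed
  obtain rk where rk: "inj_on rk A" "\<And>v. v \<in> A \<Longrightarrow> rk v < card A"
    "\<And>v. v \<in> A \<Longrightarrow> real (rk v + 1) * real (degree E v) \<le> (\<Sum>v\<in>A. real (degree E v))"
    using exists_rank[OF finA, of "\<lambda>v. real (degree E v)"] by auto
  define block where "block v = rk v div h" for v
  have block: "real (block v) * (real n / 5) \<le> real (rk v)" for v
  proof -
    have "real (block v) * (real n / 5) \<le> real (block v) * real h" using h by (intro mult_left_mono) auto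
    also have "\<dots> = real (block v * h)" by simp
    also have "\<dots> \<le> real (rk v)" unfolding block_def by (intro of_nat_mono div_times_less_eq_dividend)
    finally show ?thesis .
  qed
  have "blocked_graph V E k n A block"
  proof
    show "finite V" "E \<subseteq> [V]\<^bsup>2\<^esup>" "2 \<le> k" using V(1,2) k by auto
    show "A \<subseteq> V" by (auto simp: A_def)
    show "real (card A) \<le> real k * real n / 512" by (rule cA)
    show "real (degree E v) \<le> 2 ^ k * real n / 128" if "v \<in> V - A" for v
      using that by (auto simp: A_def)
    show "real (block v) * real (degree E v) \<le> real k * 2 ^ k * real n / 128" if "v \<in> A" for v
    proof -
      have "real (block v) * (real n / 5) * real (degree E v) \<le> real (rk v + 1) * real (degree E v)"
        using block[of v] by (intro mult_right_mono) auto
      also have "\<dots> \<le> real k * 2 ^ k * real n ^ 2 / 2 ^ 16" using rk(3)[OF that] degA by linarith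
      also have "\<dots> \<le> real k * 2 ^ k * real n / 128 * (real n / 5)" by (simp add: power2_eq_square)
      finally have "(real (block v) * real (degree E v)) * (real n / 5) \<le> real k * 2 ^ k * real n / 128 * (real n / 5)"
        by (simp add: mult_ac)
      then show ?thesis using n by (subst (asm) mult_le_cancel_right) auto
    qed
    show "2 * block v < k" if "v \<in> A" for v
    proof -
      have "real (rk v) < real (card A)" using rk(2)[OF that] by simp
      then have "real (block v) * (real n / 5) < real k * real n / 512" using block[of v] cA by linarith
      also have "\<dots> \<le> real k / 2 * (real n / 5)" by simp
      finally have "real (block v) < real k / 2" using n by (subst (asm) mult_less_cancel_right) auto
      then show ?thesis by linarith
    qed
    show "card {v \<in> A. block v = j} \<le> n div 4" for j
    proof -
      have "rk ` {v \<in> A. block v = j} \<subseteq> {j * h..<j * h + h}"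
      proof
        fix r assume "r \<in> rk ` {v \<in> A. block v = j}"
        then have "r div h = j" by (auto simp: block_def)
        then have "r = j * h + r mod h" by (metis div_mult_mod_eq)
        moreover have "r mod h < h" using h0 by simp
        ultimately show "r \<in> {j * h..<j * h + h}" by (metis atLeastLessThan_iff le_add1 nat_add_left_cancel_less)
      qed
      moreover have "inj_on rk {v \<in> A. block v = j}" using rk(1) by (rule inj_on_subset) auto
      ultimately have "card {v \<in> A. block v = j} \<le> card {j * h..<j * h + h}"
        by (intro card_inj_on_le) auto
      then show ?thesis by (simp add: h_def)
    qed
    have "card V \<le> (\<Sum>e\<in>E. card e)"
      unfolding V(3) by (rule card_Union_le_sum_card)
    also have "\<dots> = (\<Sum>e\<in>E. 2)" using V(2) by (intro sum.cong) (auto simp: nsets_def)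
    finally have "card V \<le> 2 * card E" by simp
    then have "real (card V) \<le> 2 * real (card E)" by linarith
    also have "\<dots> \<le> real k * 2 ^ k * real n ^ 2"
    proof -
      have "0 \<le> real k * 2 ^ k * real n ^ 2" by simp
      moreover have "real (card E) \<le> real k * 2 ^ k * real n ^ 2 / 131072" using few by simp
      ultimately show ?thesis by linarith
    qed
    finally have "real (card V) ^ k \<le> (real k * 2 ^ k * real n ^ 2) ^ k" by (intro power_mono) auto
    then have "2 * real (card V) ^ k * exp (real n / 8) \<le> 2 * (real k * 2 ^ k * real n ^ 2) ^ k * exp (real n / 8)"
      by (intro mult_right_mono mult_left_mono) auto
    then show "2 * real (card V) ^ k * exp (real n / 8) < 2 ^ (n div 2)" using large by linarith
  qed
  then show ?thesis by blast
qed

lemma card_edges_Ramsey_graph_for_book: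
  assumes k: "k \<ge> 2"
  shows "\<exists>n0. \<forall>n\<ge>n0. \<forall>G :: 'a graph. finite_simple_graph G \<longrightarrow> ramsey_for G (book k n) \<longrightarrow>
    real k * 2 ^ k * real n ^ 2 / 2 ^ 17 \<le> real (card (edges G))"
proof -
  obtain n0 where n0: "\<And>n. n \<ge> n0 \<Longrightarrow>
      2 * (real k * 2 ^ k * real n ^ 2) ^ k * exp (real n / 8) < 2 ^ (n div 2)"
    using eventually_power_exp_less by blast
  show ?thesis
  proof (intro exI[of _ "n0 + 15"] allI impI, rule ccontr)
    fix n and G :: "'a graph"
    assume n: "n0 + 15 \<le> n" and G: "finite_simple_graph G" "ramsey_for G (book k n)"
      and "\<not> real k * 2 ^ k * real n ^ 2 / 2 ^ 17 \<le> real (card (edges G))"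
    then have few: "real (card (edges G)) \<le> real k * 2 ^ k * real n ^ 2 / 2 ^ 17" by linarith
    \<comment> \<open>Isolated vertices are dropped, so that \<open>card V\<close> is at most twice
      the number of edges and the number of possible spines is polynomial in \<open>n\<close>. Spine
      and pages of a book lie in \<open>V\<close>, since each of their vertices is on an
      edge.\<close>
    define V where "V = \<Union>(edges G)"
    have "V \<subseteq> verts G" using G(1) by (auto simp: V_def finite_simple_graph_def nsets_def)
    then have finV: "finite V" using G(1) finite_subset by (auto simp: finite_simple_graph_def)
    have "edges G \<subseteq> [V]\<^bsup>2\<^esup>"
      using G(1) by (auto simp: V_def finite_simple_graph_def nsets_def)
    then obtain A block where "blocked_graph V (edges G) k n A block"
      using exists_blocked_graph[OF k _ finV _ V_def few n0] n by auto
    then interpret blocked_graph V "edges G" k n A block .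
    obtain \<chi> :: "'a set \<Rightarrow> bool" where \<chi>: "\<And>K P c. K \<inter> P = {} \<Longrightarrow> card K = k \<Longrightarrow> K \<subseteq> V \<Longrightarrow> P \<subseteq> V \<Longrightarrow>
      (\<And>u v. u \<in> K \<Longrightarrow> v \<in> K \<union> P \<Longrightarrow> u \<noteq> v \<Longrightarrow> {u, v} \<in> edges G \<and> \<chi> {u, v} = c) \<Longrightarrow> card P < n"
    proof (rule exists_colouring_without_book, goal_cases)
      case (1 \<chi>)
      from 1(2) show ?case by (rule 1(1))
    qed
    obtain F c where F: "copy_of F (book k n) G" and c: "\<And>e. e \<in> edges F \<Longrightarrow> \<chi> e = c"
      using G(2)[unfolded ramsey_for_def, THEN spec, of \<chi>] by blast
    obtain K P where KP: "K \<inter> P = {}" "card K = k" "card P = n"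
      and e: "\<forall>u\<in>K. \<forall>v\<in>K \<union> P. u \<noteq> v \<longrightarrow> {u, v} \<in> edges F"
      using copy_of_bookD[OF F] by blast
    have FG: "edges F \<subseteq> edges G" using F by (simp add: copy_of_def subgraph_def)
    have uv: "u \<in> V \<and> v \<in> V" if "u \<in> K" "v \<in> P" for u v
    proof -
      have "u \<noteq> v" using that KP(1) by blast
      then have "{u, v} \<in> edges G" using that e FG by (simp add: subset_iff)
      then show ?thesis by (auto simp: V_def)
    qed
    have "K \<noteq> {}" "P \<noteq> {}" using KP k n by auto
    then have "K \<subseteq> V" "P \<subseteq> V" using uv by blast+
    then have "card P < n"
    proof (rule \<chi>[OF KP(1,2)])
      show "{u, v} \<in> edges G \<and> \<chi> {u, v} = c" if "u \<in> K" "v \<in> K \<union> P" "u \<noteq> v" for u v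
      proof -
        have "{u, v} \<in> edges F" using e that by simp
        then show ?thesis using c FG by (simp add: subset_iff)
      qed
    qed
    then show False using KP by simp
  qed
qed

theorem theorem1p3:
  shows "\<exists>c C :: real. c > 0 \<and> C > 0 \<and>
    (\<forall>k :: nat. k \<ge> 2 \<longrightarrow> (\<exists>n\<^sub>0 :: nat. \<forall>n :: nat. n \<ge> n\<^sub>0 \<longrightarrow>
       c * real k * 2 ^ k * real n ^ 2 \<le> real (size_ramsey (book k n)) \<and>
       real (size_ramsey (book k n)) \<le> C * real k * 2 ^ k * real n ^ 2))"
proof (rule exI[of _ "1 / 2 ^ 17"], rule exI[of _ 117], intro conjI allI impI)
  fix k :: nat assume k: "k \<ge> 2"
  obtain n1 where n1: "\<And>n. n \<ge> n1 \<Longrightarrow> \<exists>G :: nat graph. finite_simple_graph G \<and> ramsey_for G (book k n) \<and>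
    real (card (edges G)) \<le> 117 * real k * 2 ^ k * real n ^ 2"
    using exists_Ramsey_graph_for_book[of k] k by auto
  obtain n2 where n2: "\<And>n (G :: nat graph). n \<ge> n2 \<Longrightarrow> finite_simple_graph G \<Longrightarrow> ramsey_for G (book k n) \<Longrightarrow>
    real k * 2 ^ k * real n ^ 2 / 2 ^ 17 \<le> real (card (edges G))"
    using card_edges_Ramsey_graph_for_book[OF k] by metis
  have "1 / 2 ^ 17 * real k * 2 ^ k * real n ^ 2 \<le> real (size_ramsey (book k n)) \<and>
       real (size_ramsey (book k n)) \<le> 117 * real k * 2 ^ k * real n ^ 2" if n: "n \<ge> max n1 n2" for n
  proof -
    define Q where "Q m \<longleftrightarrow> (\<exists>G :: nat graph. finite_simple_graph G \<and> ramsey_for G (book k n) \<and> card (edges G) = m)" for m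
    have size: "size_ramsey (book k n) = (LEAST m. Q m)" by (simp add: size_ramsey_def Q_def)
    obtain G :: "nat graph" where G: "finite_simple_graph G" "ramsey_for G (book k n)"
      and le: "real (card (edges G)) \<le> 117 * real k * 2 ^ k * real n ^ 2"
      using n1[of n] n by auto
    have QG: "Q (card (edges G))" unfolding Q_def using G by blast
    \<comment> \<open>The graph of the upper bound shows that the minimum is attained, so the lower
      bound applies to a minimiser.\<close>
    then have "Q (LEAST m. Q m)" by (rule LeastI)
    then obtain H :: "nat graph" where "finite_simple_graph H" "ramsey_for H (book k n)"
      and "card (edges H) = size_ramsey (book k n)" unfolding size Q_def by blast
    then have "real k * 2 ^ k * real n ^ 2 / 2 ^ 17 \<le> real (size_ramsey (book k n))"
      using n2[of n H] n by simp
    moreover have "size_ramsey (book k n) \<le> card (edges G)" unfolding size using QG by (rule Least_le)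
    then have "real (size_ramsey (book k n)) \<le> real (card (edges G))" by (rule of_nat_mono)
    ultimately show ?thesis using le by simp
  qed
  then show "\<exists>n\<^sub>0. \<forall>n\<ge>n\<^sub>0. 1 / 2 ^ 17 * real k * 2 ^ k * real n ^ 2 \<le> real (size_ramsey (book k n)) \<and>
       real (size_ramsey (book k n)) \<le> 117 * real k * 2 ^ k * real n ^ 2" by blast
qed simp_all

end
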